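(* In the partition-wise setting of the context (partition-wise homogeneous price sensitivities, separable CPGF, and partition-wise decomposable uncertainty set $\mathcal{A}=\mathcal{A}^1\times\dots\times\mathcal{A}^N$), the robust problem $\max_{x\in\mathbb{R}^m}\min_{(a,b)\in\mathcal{A}}\Phi(x,a,b)$ yields a unique partition-wise constant-markup solution $x^*$ such that $x^*_i=z^*_n+c_i$ for all $n\in\{1,\dots,N\}$ and $i\in\mathcal{V}_n$, where $z^*$ is the unique solution of $$\max_{z\in\mathbb{R}^N}\ \min_{(a,b)\in\mathcal{A}}\ \frac{\sum_{n=1}^N z_nG^n(Y^n|z_n,a^n,b^n)}{1+\sum_{n=1}^N G^n(Y^n|z_n,a^n,b^n)},$$ a problem which can be solved by convex optimization. Moreover, $(x^*,a^*(z^* ),b^*(z^* ))$ is a saddle point of the robust problem and the minimax equality holds: $$\max_{x\in\mathbb{R}^m}\min_{(a,b)\in\mathcal{A}}\Phi(x,a,b)=\min_{(a,b)\in\mathcal{A}}\max_{x\in\mathbb{R}^m}\Phi(x,a,b).$$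
   Context: A GEV choice probability generating function (CPGF) on $k$ products is a smooth function $G$ of vectors $Y=(Y_1,\dots,Y_k)$ with positive entries such that: (i) $G(Y)\ge 0$; (ii) $G(\lambda Y)=\lambda G(Y)$ for $\lambda>0$; (iii) $G(Y)\to\infty$ if $Y_i\to\infty$; (iv) for distinct indices $i_1,\dots,i_j$, the mixed partial derivative $\partial G_{i_1,\dots,i_j}(Y)$ is $>0$ if $j$ is odd and $\le 0$ if $j$ is even. (Consequently $G(Y)=\sum_i Y_i\partial G_i(Y)$ and $\sum_j Y_j\partial G_{ij}(Y)=0$ for all $i$.) Partition-wise setting: the products $\mathcal{V}=\{1,\dots,m\}$, with costs $c\in\mathbb{R}^m$, are partitioned into nonempty disjoint subsets $\mathcal{V}_1,\dots,\mathcal{V}_N$. For each $n$, $G^n$ is a CPGF in the variables $Y^n=(Y_i)_{i\in\mathcal{V}_n}$, and $G(Y)=\sum_{n=1}^N G^n(Y^n)$. The uncertainty set is $\mathcal{A}=\mathcal{A}^1\times\dots\times\mathcal{A}^N$ with each $\mathcal{A}^n\subset\mathbb{R}^{2|\mathcal{V}_n|}$ nonempty, convex and compact, and for every $(a^n,b^n)\in\mathcal{A}^n$ the entries of $b^n=(b_i)_{i\in\mathcal{V}_n}$ are all equal and positive. For $z_n\in\mathbb{R}$, $G^n(Y^n|z_n,a^n,b^n):=G^n\big((e^{a_i-b_i(z_n+c_i)})_{i\in\mathcal{V}_n}\big)$, $\underline{\mathcal{G}}^n(z_n)=\min_{(a^n,b^n)\in\mathcal{A}^n}G^n(Y^n|z_n,a^n,b^n)$,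 $(a^{n*}(z_n),b^{n*}(z_n))$ denotes the unique minimizer, and $(a^*(z),b^*(z))=\{(a^{n*}(z_n),b^{n*}(z_n)):n=1,\dots,N\}$. $\Phi(x,a,b)=\sum_{i=1}^m(x_i-c_i)P_i$, where $P_i=Y_i\partial G_i(Y)/(1+G(Y))$ with $Y_i=\exp(a_i-b_ix_i)$. A saddle point $(x^*,a^*,b^* )$ means $\Phi(x,a^*,b^* )\le\Phi(x^*,a^*,b^* )\le\Phi(x^*,a,b)$ for all $x\in\mathbb{R}^m$, $(a,b)\in\mathcal{A}$. "Can be solved by convex optimization" means: $z^*$ is obtained by maximizing the strictly concave function $p\mapsto\mathcal{W}(z(p))$ over $\{p\in\mathbb{R}^N:p_n>0,\ \sum_np_n<1\}$, where $\mathcal{W}(z)=\sum_nz_n\underline{\mathcal{G}}^n(z_n)/(1+\sum_n\underline{\mathcal{G}}^n(z_n))$ and $z(p)$ is the unique vector with $p_n=\underline{\mathcal{G}}^n(z_n)/(1+\sum_l\underline{\mathcal{G}}^l(z_l))$ for all $n$.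
   Formalization: The minimizer (a*(z* ),b*(z* )) need not be unique under the stated hypotheses; the saddle-point claim for it is proved when the block minimizers at z* are unique, and in general it is proved that some choice of block minimizers at z* forms a saddle point with x*. *)

theory Defs
  imports "HOL-Analysis.Analysis"
begin

definition partial_deriv :: "'i::finite \<Rightarrow> (real^'i \<Rightarrow> real) \<Rightarrow> real^'i \<Rightarrow> real" where
  "partial_deriv i f Y = deriv (\<lambda>t. f (Y + t *\<^sub>R axis i 1)) 0"

definition mixed_partial :: "'i::finite list \<Rightarrow> (real^'i \<Rightarrow> real) \<Rightarrow> real^'i \<Rightarrow> real" where
  "mixed_partial is f = foldr partial_deriv is f"

text \<open>A vector \<open>(Y\<^sub>i)\<close> indexed by a subset \<open>I\<close> of the products is represented inside \<open>real^'i\<close>, and a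
  function of such vectors by a function on \<open>real^'i\<close> that does not depend on the coordinates
  outside \<open>I\<close>.\<close>

definition pos_vectors :: "'i::finite set \<Rightarrow> (real^'i) set" where
  "pos_vectors I = {Y. \<forall>i\<in>I. Y $ i > 0}"

definition depends_only_on :: "'i::finite set \<Rightarrow> (real^'i \<Rightarrow> real) \<Rightarrow> bool" where
  "depends_only_on I f \<longleftrightarrow>
     (\<forall>Y\<in>pos_vectors I. \<forall>Z\<in>pos_vectors I. (\<forall>i\<in>I. Y $ i = Z $ i) \<longrightarrow> f Y = f Z)"

text \<open>Smooth means \<open>C\<^sup>\<infinity>\<close>: on an open set this is equivalent to Frechet differentiability of all
  iterated partial derivatives (differentiability of the next order gives continuity).\<close>

definition smooth_pos :: "'i::finite set \<Rightarrow> (real^'i \<Rightarrow> real) \<Rightarrow> bool" where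
  "smooth_pos I f \<longleftrightarrow>
     (\<forall>is. set is \<subseteq> I \<longrightarrow> (\<forall>Y\<in>pos_vectors I. mixed_partial is f differentiable (at Y)))"

text \<open>In the limit condition the entries other than \<open>Y\<^sub>i\<close> are kept fixed.\<close>

definition cpgf :: "'i::finite set \<Rightarrow> (real^'i \<Rightarrow> real) \<Rightarrow> bool" where
  "cpgf I G \<longleftrightarrow>
     depends_only_on I G \<and> smooth_pos I G \<and>
     (\<forall>Y\<in>pos_vectors I. G Y \<ge> 0) \<and>
     (\<forall>Y\<in>pos_vectors I. \<forall>t>0. G (t *\<^sub>R Y) = t * G Y) \<and>
     (\<forall>Y\<in>pos_vectors I. \<forall>i\<in>I.
        filterlim (\<lambda>t. G (\<chi> j. if j = i then t else Y $ j)) at_top at_top) \<and>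
     (\<forall>Y\<in>pos_vectors I. \<forall>is. is \<noteq> [] \<and> distinct is \<and> set is \<subseteq> I \<longrightarrow>
        (if odd (length is) then mixed_partial is G Y > 0 else mixed_partial is G Y \<le> 0))"

type_synonym 'i params = "(real^'i) \<times> (real^'i)"

text \<open>The space \<open>\<real>\<^bsup>2|I|\<^esup>\<close> of pairs \<open>((a\<^sub>i), (b\<^sub>i))\<close> with \<open>i \<in> I\<close> is the linear subspace of the pairs
  that vanish outside \<open>I\<close>; convexity and compactness are unaffected by this embedding.\<close>

definition block_params :: "'i::finite set \<Rightarrow> ('i params) set" where
  "block_params I = {(a, b). \<forall>i. i \<notin> I \<longrightarrow> a $ i = 0 \<and> b $ i = 0}"

definition restrict_params :: "'i::finite set \<Rightarrow> 'i params \<Rightarrow> 'i params" where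
  "restrict_params I ab =
     ((\<chi> i. if i \<in> I then fst ab $ i else 0), (\<chi> i. if i \<in> I then snd ab $ i else 0))"

text \<open>The Cartesian product of the sets \<open>A n\<close>.\<close>

definition product_set :: "('n \<Rightarrow> 'i::finite set) \<Rightarrow> ('n \<Rightarrow> ('i params) set) \<Rightarrow> ('i params) set" where
  "product_set V A = {ab. \<forall>n. restrict_params (V n) ab \<in> A n}"

definition total_G :: "('n::finite \<Rightarrow> real^'i::finite \<Rightarrow> real) \<Rightarrow> real^'i \<Rightarrow> real" where
  "total_G G Y = (\<Sum>n\<in>UNIV. G n Y)"

definition price_Y :: "real^'i::finite \<Rightarrow> 'i params \<Rightarrow> real^'i" where
  "price_Y x ab = (\<chi> i. exp (fst ab $ i - snd ab $ i * x $ i))"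

definition choice_prob ::
    "('n::finite \<Rightarrow> real^'i::finite \<Rightarrow> real) \<Rightarrow> real^'i \<Rightarrow> 'i params \<Rightarrow> 'i \<Rightarrow> real" where
  "choice_prob G x ab i =
     (let Y = price_Y x ab in Y $ i * partial_deriv i (total_G G) Y / (1 + total_G G Y))"

definition revenue ::
    "('n::finite \<Rightarrow> real^'i::finite \<Rightarrow> real) \<Rightarrow> real^'i \<Rightarrow> real^'i \<Rightarrow> 'i params \<Rightarrow> real" where
  "revenue G c x ab = (\<Sum>i\<in>UNIV. (x $ i - c $ i) * choice_prob G x ab i)"

definition saddle_point :: "('x \<Rightarrow> 'y \<Rightarrow> real) \<Rightarrow> 'x set \<Rightarrow> 'y set \<Rightarrow> 'x \<Rightarrow> 'y \<Rightarrow> bool" where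
  "saddle_point f X S xs ys \<longleftrightarrow>
     xs \<in> X \<and> ys \<in> S \<and> (\<forall>x\<in>X. f x ys \<le> f xs ys) \<and> (\<forall>y\<in>S. f xs ys \<le> f xs y)"

text \<open>\<open>markup_G (G n) c z ab\<close> is \<open>G\<^sup>n(Y\<^sup>n | z, a\<^sup>n, b\<^sup>n)\<close>; entries of \<open>ab\<close> outside the block \<open>V n\<close> are
  irrelevant because \<open>G n\<close> does not depend on the corresponding coordinates.\<close>

definition markup_G ::
    "(real^'i::finite \<Rightarrow> real) \<Rightarrow> real^'i \<Rightarrow> real \<Rightarrow> 'i params \<Rightarrow> real" where
  "markup_G Gn c z ab = Gn (\<chi> i. exp (fst ab $ i - snd ab $ i * (z + c $ i)))"

definition lower_G ::
    "(real^'i::finite \<Rightarrow> real) \<Rightarrow> real^'i \<Rightarrow> ('i params) set \<Rightarrow> real \<Rightarrow> real" where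
  "lower_G Gn c An z = (INF ab\<in>An. markup_G Gn c z ab)"

definition worst_params ::
    "(real^'i::finite \<Rightarrow> real) \<Rightarrow> real^'i \<Rightarrow> ('i params) set \<Rightarrow> real \<Rightarrow> 'i params \<Rightarrow> bool" where
  "worst_params Gn c An z ab \<longleftrightarrow> is_arg_min (markup_G Gn c z) (\<lambda>ab. ab \<in> An) ab"

text \<open>The pair \<open>(a\<^sup>*(z), b\<^sup>*(z))\<close>: since the blocks are zero outside disjoint sets, summing them
  assembles the full vectors. It is meaningful when each block minimizer is unique.\<close>

definition worst_params_at ::
    "('n::finite \<Rightarrow> real^'i::finite \<Rightarrow> real) \<Rightarrow> real^'i \<Rightarrow> ('n \<Rightarrow> ('i params) set) \<Rightarrow> real^'n \<Rightarrow>
     'i params" where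
  "worst_params_at G c A z = (\<Sum>n\<in>UNIV. THE ab. worst_params (G n) c (A n) (z $ n) ab)"

definition markup_revenue ::
    "('n::finite \<Rightarrow> real^'i::finite \<Rightarrow> real) \<Rightarrow> real^'i \<Rightarrow> real^'n \<Rightarrow> 'i params \<Rightarrow> real" where
  "markup_revenue G c z ab =
     (\<Sum>n\<in>UNIV. z $ n * markup_G (G n) c (z $ n) ab) / (1 + (\<Sum>n\<in>UNIV. markup_G (G n) c (z $ n) ab))"

definition lower_revenue ::
    "('n::finite \<Rightarrow> real^'i::finite \<Rightarrow> real) \<Rightarrow> real^'i \<Rightarrow> ('n \<Rightarrow> ('i params) set) \<Rightarrow> real^'n \<Rightarrow> real" where
  "lower_revenue G c A z =
     (\<Sum>n\<in>UNIV. z $ n * lower_G (G n) c (A n) (z $ n)) /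
     (1 + (\<Sum>n\<in>UNIV. lower_G (G n) c (A n) (z $ n)))"

definition open_simplex :: "(real^'n::finite) set" where
  "open_simplex = {p. (\<forall>n. p $ n > 0) \<and> (\<Sum>n\<in>UNIV. p $ n) < 1}"

definition has_probs ::
    "('n::finite \<Rightarrow> real^'i::finite \<Rightarrow> real) \<Rightarrow> real^'i \<Rightarrow> ('n \<Rightarrow> ('i params) set) \<Rightarrow> real^'n \<Rightarrow> real^'n \<Rightarrow>
     bool" where
  "has_probs G c A p z \<longleftrightarrow>
     (\<forall>n. p $ n = lower_G (G n) c (A n) (z $ n) / (1 + (\<Sum>l\<in>UNIV. lower_G (G l) c (A l) (z $ l))))"

definition markup_of_probs ::
    "('n::finite \<Rightarrow> real^'i::finite \<Rightarrow> real) \<Rightarrow> real^'i \<Rightarrow> ('n \<Rightarrow> ('i params) set) \<Rightarrow> real^'n \<Rightarrow> real^'n" where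
  "markup_of_probs G c A p = (THE z. has_probs G c A p z)"

definition strictly_concave_on :: "'a::real_vector set \<Rightarrow> ('a \<Rightarrow> real) \<Rightarrow> bool" where
  "strictly_concave_on S f \<longleftrightarrow> convex S \<and>
     (\<forall>x\<in>S. \<forall>y\<in>S. x \<noteq> y \<longrightarrow>
        (\<forall>t. 0 < t \<and> t < 1 \<longrightarrow> f ((1 - t) *\<^sub>R x + t *\<^sub>R y) > (1 - t) * f x + t * f y))"

text \<open>Minima and maxima of real functions are written with \<open>INF\<close> and \<open>SUP\<close>; these predicates
  express that the extremum is attained, so that the bound is a genuine minimum or maximum.\<close>

definition attains_min :: "('a \<Rightarrow> real) \<Rightarrow> 'a set \<Rightarrow> bool" where
  "attains_min f S \<longleftrightarrow> (\<exists>x. is_arg_min f (\<lambda>x. x \<in> S) x)"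

definition attains_max :: "('a \<Rightarrow> real) \<Rightarrow> 'a set \<Rightarrow> bool" where
  "attains_max f S \<longleftrightarrow> (\<exists>x. is_arg_max f (\<lambda>x. x \<in> S) x)"

definition unique_maximizer :: "('a \<Rightarrow> real) \<Rightarrow> 'a set \<Rightarrow> 'a \<Rightarrow> bool" where
  "unique_maximizer f S xs \<longleftrightarrow> (\<forall>x. is_arg_max f (\<lambda>x. x \<in> S) x \<longleftrightarrow> x = xs)"

end

theory Submission
  imports Defs
begin

text \<open>Each \<open>G\<^sup>n\<close> is convex: its Hessian, scaled by \<open>Y\<^sub>i Y\<^sub>j\<close>, is a graph Laplacian. With homogeneity
  this gives, for utilities \<open>u\<close>, \<open>v\<close> and the choice probabilities \<open>q\<close> within a block at \<open>u\<close>, the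
  inequality \<open>G\<^sup>n(e\<^sup>v) \<ge> G\<^sup>n(e\<^sup>u) exp (\<Sum> q\<^sub>i (v\<^sub>i - u\<^sub>i))\<close>, strict unless \<open>v - u\<close> is constant on the
  block. Hence replacing the markups of a block by their \<open>q\<close>-average can only increase \<open>G\<^sup>n\<close>.

  A revenue \<open>\<Sum> z\<^sub>n g\<^sub>n / (1 + \<Sum> g\<^sub>n)\<close> is at most \<open>W\<close> iff \<open>\<Sum> (z\<^sub>n - W) g\<^sub>n \<le> W\<close>, and this condition separates
  over the blocks. Let \<open>m\<^sub>n(W)\<close> be the minimum over \<open>A n\<close> of \<open>max\<^sub>z (z - W) G\<^sup>n(z)\<close> and choose \<open>W\<close> with
  \<open>\<Sum> m\<^sub>n(W) = W\<close>. The minimizing parameters, with sensitivities \<open>b\<^sub>n\<close>, and the best responses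
  \<open>z\<^sub>n = W + 1 / b\<^sub>n\<close> form a saddle point: by log-convexity of \<open>G\<^sup>n\<close> in the parameters, the first-order
  condition for \<open>m\<^sub>n(W)\<close> says that they also minimize \<open>G\<^sup>n(z\<^sub>n)\<close>.\<close>

section \<open>Partial derivatives\<close>

text \<open>Links \<open>partial_deriv\<close>, a derivative along one axis, with the Frechet
  derivative: the latter is linear and hence fixed by its values on the basis vectors.\<close>

lemma differentiable_partial_deriv:
  fixes f :: "real^'i::finite \<Rightarrow> real"
  assumes "f differentiable (at Y)"
  shows "(f has_derivative (\<lambda>v. \<Sum>i\<in>UNIV. v $ i * partial_deriv i f Y)) (at Y)"
proof -
  obtain f' where f': "(f has_derivative f') (at Y)"
    using assms by (auto simp: differentiable_def)
  then interpret bounded_linear f' by (rule has_derivative_bounded_linear)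
  have partial: "partial_deriv i f Y = f' (axis i 1)" for i
  proof -
    have "((\<lambda>t. f (Y + t *\<^sub>R axis i 1)) has_derivative (\<lambda>t. f' (t *\<^sub>R axis i 1))) (at 0)"
      by (rule has_derivative_compose[where f = "\<lambda>t. Y + t *\<^sub>R axis i 1" and g = f, simplified])
        (auto intro!: derivative_eq_intros f')
    then have "((\<lambda>t. f (Y + t *\<^sub>R axis i 1)) has_field_derivative f' (axis i 1)) (at 0)"
      unfolding has_field_derivative_def
      by (rule has_derivative_eq_rhs) (simp add: fun_eq_iff scaleR mult.commute)
    then show ?thesis
      by (simp add: partial_deriv_def DERIV_imp_deriv)
  qed
  have "f' v = (\<Sum>i\<in>UNIV. v $ i * partial_deriv i f Y)" for v
  proof -
    have "f' v = f' (\<Sum>i\<in>UNIV. v $ i *\<^sub>R axis i 1)"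
      by (simp add: basis_expansion flip: scalar_mult_eq_scaleR)
    also have "\<dots> = (\<Sum>i\<in>UNIV. v $ i * partial_deriv i f Y)"
      by (simp add: sum scaleR partial)
    finally show ?thesis .
  qed
  then show ?thesis by (intro has_derivative_eq_rhs[OF f']) auto
qed

lemma has_real_derivative_along_line:
  fixes f :: "real^'i::finite \<Rightarrow> real"
  assumes "f differentiable (at (Y + t *\<^sub>R D))"
  shows "((\<lambda>t. f (Y + t *\<^sub>R D)) has_real_derivative
    (\<Sum>i\<in>UNIV. D $ i * partial_deriv i f (Y + t *\<^sub>R D))) (at t)"
proof -
  have "((\<lambda>t. f (Y + t *\<^sub>R D)) has_derivative
      (\<lambda>s. \<Sum>i\<in>UNIV. (s *\<^sub>R D) $ i * partial_deriv i f (Y + t *\<^sub>R D))) (at t)"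
    by (rule has_derivative_compose[where f = "\<lambda>t. Y + t *\<^sub>R D" and g = f])
      (auto intro!: derivative_eq_intros differentiable_partial_deriv assms)
  then show ?thesis
    unfolding has_field_derivative_def
    by (rule has_derivative_eq_rhs) (simp add: fun_eq_iff sum_distrib_left mult_ac)
qed

lemma partial_deriv_sum:
  fixes f :: "'n \<Rightarrow> real^'i::finite \<Rightarrow> real"
  assumes "\<And>n. n \<in> N \<Longrightarrow> f n differentiable (at Y)"
  shows "partial_deriv i (\<lambda>Y. \<Sum>n\<in>N. f n Y) Y = (\<Sum>n\<in>N. partial_deriv i (f n) Y)"
proof -
  have "((\<lambda>t. f n (Y + t *\<^sub>R axis i 1)) has_real_derivative partial_deriv i (f n) Y) (at 0)"
    if "n \<in> N" for n
  proof -
    have "(\<lambda>t. f n (Y + t *\<^sub>R axis i 1)) field_differentiable (at 0)"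
      using has_real_derivative_along_line[of "f n" Y 0 "axis i 1"] assms[OF that]
      by (auto simp: field_differentiable_def)
    then show ?thesis
      unfolding partial_deriv_def using field_differentiable_derivI by blast
  qed
  then have "((\<lambda>t. \<Sum>n\<in>N. f n (Y + t *\<^sub>R axis i 1)) has_real_derivative
      (\<Sum>n\<in>N. partial_deriv i (f n) Y)) (at 0)"
    by (intro DERIV_sum)
  then show ?thesis
    unfolding partial_deriv_def by (rule DERIV_imp_deriv)
qed

section \<open>Positive vectors and functions of a block of coordinates\<close>

lemma open_pos_vectors: "open (pos_vectors I :: (real^'i::finite) set)"
proof -
  have "open (\<Inter>i\<in>I. {Y :: real^'i. Y $ i > 0})"
    by (intro open_INT ballI open_Collect_less continuous_on_component continuous_on_const
      continuous_on_id) simp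
  moreover have "(\<Inter>i\<in>I. {Y :: real^'i. Y $ i > 0}) = pos_vectors I"
    by (auto simp: pos_vectors_def)
  ultimately show ?thesis by simp
qed

lemma pos_vectors_scaleR: "Y \<in> pos_vectors I \<Longrightarrow> t > 0 \<Longrightarrow> t *\<^sub>R Y \<in> pos_vectors I"
  by (simp add: pos_vectors_def)

lemma eventually_line_pos_vectors:
  fixes Y :: "real^'i::finite"
  assumes "Y \<in> pos_vectors I"
  shows "\<forall>\<^sub>F t in nhds 0. Y + t *\<^sub>R v \<in> pos_vectors I"
proof -
  have "((\<lambda>t. Y + t *\<^sub>R v) \<longlongrightarrow> Y + 0 *\<^sub>R v) (nhds (0::real))"
    by (intro tendsto_intros filterlim_ident)
  then have "filterlim (\<lambda>t. Y + t *\<^sub>R v) (nhds Y) (nhds (0::real))" by simp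
  then show ?thesis
    using topological_tendstoD[OF _ open_pos_vectors assms] by blast
qed

lemma depends_only_onD:
  assumes "depends_only_on I f" "Y \<in> pos_vectors I" "\<And>i. i \<in> I \<Longrightarrow> Z $ i = Y $ i"
  shows "f Z = f Y"
proof -
  have "Z \<in> pos_vectors I"
    using assms(2,3) by (simp add: pos_vectors_def)
  with assms show ?thesis
    unfolding depends_only_on_def by blast
qed

lemma partial_deriv_outside:
  assumes "depends_only_on I f" "Y \<in> pos_vectors I" "i \<notin> I"
  shows "partial_deriv i f Y = 0"
proof -
  have "(Y + t *\<^sub>R axis i 1) $ j = Y $ j" if "j \<in> I" for j t
    using that assms(3) by (cases "i = j") (auto simp: axis_def)
  then have "f (Y + t *\<^sub>R axis i 1) = f Y" for t
    by (rule depends_only_onD[OF assms(1,2)])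
  then show ?thesis by (simp add: partial_deriv_def)
qed

text \<open>With zero row and column sums, twice the form equals the sum of
  \<open>- L i j * (d i - d j)\<^sup>2\<close>, which is termwise nonnegative. The two kinds of sums
  take the place of symmetry of \<open>L\<close>, so mixed partial derivatives never have to be
  exchanged.\<close>

lemma quadratic_form_nonneg:
  fixes L :: "'i \<Rightarrow> 'i \<Rightarrow> real"
  assumes "finite I"
    and off: "\<And>i j. i \<in> I \<Longrightarrow> j \<in> I \<Longrightarrow> i \<noteq> j \<Longrightarrow> L i j \<le> 0"
    and row: "\<And>i. i \<in> I \<Longrightarrow> (\<Sum>j\<in>I. L i j) = 0"
    and col: "\<And>j. j \<in> I \<Longrightarrow> (\<Sum>i\<in>I. L i j) = 0"
  shows "(\<Sum>i\<in>I. \<Sum>j\<in>I. L i j * d i * d j) \<ge> 0"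
proof -
  have "0 \<le> (\<Sum>i\<in>I. \<Sum>j\<in>I. - L i j * (d i - d j)\<^sup>2)"
  proof (intro sum_nonneg)
    fix i j assume "i \<in> I" "j \<in> I"
    then show "0 \<le> - L i j * (d i - d j)\<^sup>2"
      using off[of i j] by (cases "i = j") (auto simp: mult_nonpos_nonneg)
  qed
  also have "\<dots> = (\<Sum>i\<in>I. \<Sum>j\<in>I. 2 * (L i j * d i * d j) - L i j * (d i)\<^sup>2 - L i j * (d j)\<^sup>2)"
    by (intro sum.cong refl) (simp add: power2_eq_square algebra_simps)
  also have "\<dots> = 2 * (\<Sum>i\<in>I. \<Sum>j\<in>I. L i j * d i * d j)
      - (\<Sum>i\<in>I. \<Sum>j\<in>I. L i j * (d i)\<^sup>2) - (\<Sum>i\<in>I. \<Sum>j\<in>I. L i j * (d j)\<^sup>2)"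
    by (simp add: sum_subtractf sum_distrib_left)
  also have "(\<Sum>i\<in>I. \<Sum>j\<in>I. L i j * (d i)\<^sup>2) = 0"
    using row by (simp flip: sum_distrib_right)
  also have "(\<Sum>i\<in>I. \<Sum>j\<in>I. L i j * (d j)\<^sup>2) = 0"
    using col by (subst sum.swap) (simp flip: sum_distrib_right)
  finally show ?thesis by simp
qed

lemma exp_gt_add_one: "x \<noteq> 0 \<Longrightarrow> 1 + x < exp (x::real)"
  using exp_minus_greater[of "- x"] by simp

section \<open>Choice probability generating functions\<close>

lemma DERIV_transfer_eventually:
  fixes f g :: "real \<Rightarrow> real"
  assumes "(f has_real_derivative D) (at x)" "\<forall>\<^sub>F t in nhds x. f t = g t"
  shows "(g has_real_derivative D) (at x)"
  using assms(1) DERIV_cong_ev[OF refl assms(2) refl] by blast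

lemma cpgf_partial_derivs:
  assumes "cpgf I G" "Y \<in> pos_vectors I"
  shows "G differentiable (at Y)"
    and "i \<in> I \<Longrightarrow> partial_deriv i G differentiable (at Y)"
    and "i \<in> I \<Longrightarrow> partial_deriv i G Y > 0"
    and "i \<in> I \<Longrightarrow> j \<in> I \<Longrightarrow> i \<noteq> j \<Longrightarrow> partial_deriv i (partial_deriv j G) Y \<le> 0"
proof -
  have diff: "set is \<subseteq> I \<Longrightarrow> mixed_partial is G differentiable (at Y)" for "is"
    using assms by (auto simp: cpgf_def smooth_pos_def)
  have sign: "is \<noteq> [] \<and> distinct is \<and> set is \<subseteq> I \<Longrightarrow>
      (if odd (length is) then mixed_partial is G Y > 0 else mixed_partial is G Y \<le> 0)" for "is"
    using assms unfolding cpgf_def by blast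
  show "G differentiable (at Y)"
    using diff[of "[]"] by (simp add: mixed_partial_def)
  show "i \<in> I \<Longrightarrow> partial_deriv i G differentiable (at Y)"
    using diff[of "[i]"] by (simp add: mixed_partial_def)
  show "i \<in> I \<Longrightarrow> partial_deriv i G Y > 0"
    using sign[of "[i]"] by (simp add: mixed_partial_def)
  show "i \<in> I \<Longrightarrow> j \<in> I \<Longrightarrow> i \<noteq> j \<Longrightarrow> partial_deriv i (partial_deriv j G) Y \<le> 0"
    using sign[of "[i, j]"] by (simp add: mixed_partial_def)
qed

lemma cpgf_depends_only: "cpgf I G \<Longrightarrow> depends_only_on I G"
  by (simp add: cpgf_def)

lemma cpgf_homogeneous: "cpgf I G \<Longrightarrow> Y \<in> pos_vectors I \<Longrightarrow> t > 0 \<Longrightarrow> G (t *\<^sub>R Y) = t * G Y"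
  by (simp add: cpgf_def)

text \<open>Both sides are the derivative at \<open>t = 0\<close> of
  \<open>G ((1 + t) *\<^sub>R Y)\<close>, once by the chain rule and once by homogeneity.\<close>

lemma cpgf_euler:
  assumes G: "cpgf I G" and Y: "Y \<in> pos_vectors I"
  shows "(\<Sum>i\<in>I. Y $ i * partial_deriv i G Y) = G Y"
proof -
  have "((\<lambda>t. G (Y + t *\<^sub>R Y)) has_real_derivative
      (\<Sum>i\<in>UNIV. Y $ i * partial_deriv i G Y)) (at 0)"
    using has_real_derivative_along_line[of G Y 0 Y] cpgf_partial_derivs(1)[OF assms] by simp
  moreover have "((\<lambda>t. G (Y + t *\<^sub>R Y)) has_real_derivative G Y) (at 0)"
  proof (rule has_field_derivative_transform_within_open[where f = "\<lambda>t. (1 + t) * G Y" and S = "{-1<..}"])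
    show "((\<lambda>t. (1 + t) * G Y) has_real_derivative G Y) (at 0)"
      by (auto intro!: derivative_eq_intros)
    fix t :: real assume "t \<in> {-1<..}"
    then have "G ((1 + t) *\<^sub>R Y) = (1 + t) * G Y"
      by (intro cpgf_homogeneous[OF assms]) simp
    then show "(1 + t) * G Y = G (Y + t *\<^sub>R Y)"
      by (simp add: algebra_simps)
  qed auto
  ultimately have "(\<Sum>i\<in>UNIV. Y $ i * partial_deriv i G Y) = G Y"
    by (rule DERIV_unique)
  moreover have "(\<Sum>i\<in>I. Y $ i * partial_deriv i G Y) = (\<Sum>i\<in>UNIV. Y $ i * partial_deriv i G Y)"
    by (rule sum.mono_neutral_left)
      (auto simp: partial_deriv_outside[OF cpgf_depends_only[OF G] Y])
  ultimately show ?thesis by simp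
qed

text \<open>Strictness comes from Euler's identity: all terms of its sum are positive and there is
  at least one.\<close>

lemma cpgf_pos:
  assumes "cpgf I G" "Y \<in> pos_vectors I" "I \<noteq> {}"
  shows "G Y > 0"
proof -
  have "(\<Sum>i\<in>I. Y $ i * partial_deriv i G Y) > 0"
    using assms(2,3) cpgf_partial_derivs(3)[OF assms(1,2)] by (intro sum_pos) (auto simp: pos_vectors_def)
  then show ?thesis using cpgf_euler[OF assms(1,2)] by simp
qed

text \<open>The gradient of a function homogeneous of degree one is homogeneous of degree zero:
  differentiate \<open>s * G (Y + (t / s) *\<^sub>R axis i 1) = G (s *\<^sub>R Y + t *\<^sub>R axis
  i 1)\<close>, valid for small \<open>t\<close>, at \<open>t = 0\<close>.\<close>

lemma cpgf_partial_deriv_scale: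
  assumes G: "cpgf I G" and Y: "Y \<in> pos_vectors I" and "s > 0"
  shows "partial_deriv i G (s *\<^sub>R Y) = partial_deriv i G Y"
proof -
  have "((\<lambda>t. G (Y + t *\<^sub>R axis i 1)) has_real_derivative partial_deriv i G Y) (at 0)"
    using has_real_derivative_along_line[of G Y 0 "axis i 1"] cpgf_partial_derivs(1)[OF G Y]
    by (simp add: axis_def if_distrib sum.delta' mult.commute if_distribR cong: if_cong)
  then have "((\<lambda>t. s * G (Y + (t / s) *\<^sub>R axis i 1)) has_real_derivative
      s * (partial_deriv i G Y * (1 / s))) (at 0)"
    by (intro DERIV_cmult DERIV_chain2[where f = "\<lambda>u. G (Y + u *\<^sub>R axis i 1)" and g = "\<lambda>t. t / s"])
      (use \<open>s > 0\<close> in \<open>auto intro!: derivative_eq_intros\<close>)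
  moreover have "\<forall>\<^sub>F t in nhds 0. s * G (Y + (t / s) *\<^sub>R axis i 1) = G (s *\<^sub>R Y + t *\<^sub>R axis i 1)"
  proof -
    have "\<forall>\<^sub>F t in nhds 0. Y + t *\<^sub>R ((1 / s) *\<^sub>R axis i 1) \<in> pos_vectors I"
      by (rule eventually_line_pos_vectors[OF Y])
    then show ?thesis
    proof eventually_elim
      case (elim t)
      then have "Y + (t / s) *\<^sub>R axis i 1 \<in> pos_vectors I" by simp
      from cpgf_homogeneous[OF G this \<open>s > 0\<close>] show ?case
        using \<open>s > 0\<close> by (simp add: algebra_simps)
    qed
  qed
  ultimately have "((\<lambda>t. G (s *\<^sub>R Y + t *\<^sub>R axis i 1)) has_real_derivative
      s * (partial_deriv i G Y * (1 / s))) (at 0)"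
    by (rule DERIV_transfer_eventually)
  then show ?thesis
    using \<open>s > 0\<close> by (simp add: partial_deriv_def DERIV_imp_deriv)
qed

text \<open>The two identities say that the rows and columns of \<open>(Y\<^sub>i Y\<^sub>j \<partial>\<^sub>i\<partial>\<^sub>jG)\<close> sum to zero.\<close>

lemma cpgf_second_euler:
  assumes G: "cpgf I G" and Y: "Y \<in> pos_vectors I" and j: "j \<in> I"
  shows "(\<Sum>i\<in>I. Y $ i * partial_deriv i (partial_deriv j G) Y) = 0"
    and "(\<Sum>i\<in>I. Y $ i * partial_deriv j (partial_deriv i G) Y) = 0"
proof -
  have "((\<lambda>t. partial_deriv j G (Y + t *\<^sub>R Y)) has_real_derivative
      (\<Sum>i\<in>UNIV. Y $ i * partial_deriv i (partial_deriv j G) Y)) (at 0)"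
    using has_real_derivative_along_line[of "partial_deriv j G" Y 0 Y] cpgf_partial_derivs(2)[OF G Y j] by simp
  moreover have "((\<lambda>t. partial_deriv j G (Y + t *\<^sub>R Y)) has_real_derivative 0) (at 0)"
  proof (rule has_field_derivative_transform_within_open[where f = "\<lambda>t. partial_deriv j G Y" and S = "{-1<..}"])
    fix t :: real assume "t \<in> {-1<..}"
    then have "partial_deriv j G ((1 + t) *\<^sub>R Y) = partial_deriv j G Y"
      by (intro cpgf_partial_deriv_scale[OF G Y]) simp
    then show "partial_deriv j G Y = partial_deriv j G (Y + t *\<^sub>R Y)"
      by (simp add: algebra_simps)
  qed auto
  ultimately have "(\<Sum>i\<in>UNIV. Y $ i * partial_deriv i (partial_deriv j G) Y) = 0"
    by (rule DERIV_unique)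
  moreover have "partial_deriv i (partial_deriv j G) Y = 0" if "i \<notin> I" for i
  proof -
    \<comment> \<open>If two points agree on \<open>I\<close>, then \<open>G\<close> agrees along
      \<open>axis j 1\<close> for small \<open>t\<close>, where the perturbed points are still
      positive.\<close>
    have "depends_only_on I (partial_deriv j G)"
      unfolding depends_only_on_def
    proof (intro ballI impI)
      fix Y Z :: "real^'a" assume YZ: "Y \<in> pos_vectors I" "\<forall>i\<in>I. Y $ i = Z $ i"
      have "\<forall>\<^sub>F t in nhds 0. G (Z + t *\<^sub>R axis j 1) = G (Y + t *\<^sub>R axis j 1)"
        using eventually_line_pos_vectors[OF YZ(1)]
        by eventually_elim (use YZ in \<open>auto intro!: depends_only_onD[OF cpgf_depends_only[OF G]]\<close>)
      then show "partial_deriv j G Y = partial_deriv j G Z"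
        unfolding partial_deriv_def by (intro deriv_cong_ev) (auto simp: eq_commute)
    qed
    from partial_deriv_outside[OF this Y that] show ?thesis .
  qed
  then have "(\<Sum>i\<in>I. Y $ i * partial_deriv i (partial_deriv j G) Y)
      = (\<Sum>i\<in>UNIV. Y $ i * partial_deriv i (partial_deriv j G) Y)"
    by (intro sum.mono_neutral_left) auto
  ultimately show "(\<Sum>i\<in>I. Y $ i * partial_deriv i (partial_deriv j G) Y) = 0" by simp
next
  \<comment> \<open>The second identity differentiates Euler's identity in direction
    \<open>j\<close>; the extra term \<open>partial_deriv j G Y\<close> from the product rule
    cancels against the derivative of the right-hand side.\<close>
  let ?e = "axis j 1 :: real^'a"
  have "((\<lambda>t. partial_deriv i G (Y + t *\<^sub>R ?e)) has_real_derivative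
      partial_deriv j (partial_deriv i G) Y) (at 0)" if "i \<in> I" for i
    using has_real_derivative_along_line[of "partial_deriv i G" Y 0 ?e] cpgf_partial_derivs(2)[OF G Y that]
    by (simp add: axis_def if_distrib sum.delta' mult.commute if_distribR cong: if_cong)
  then have "((\<lambda>t. \<Sum>i\<in>I. (Y + t *\<^sub>R ?e) $ i * partial_deriv i G (Y + t *\<^sub>R ?e)) has_real_derivative
      (\<Sum>i\<in>I. Y $ i * partial_deriv j (partial_deriv i G) Y + ?e $ i * partial_deriv i G Y)) (at 0)"
    by (intro DERIV_sum) (auto intro!: derivative_eq_intros)
  moreover have "\<forall>\<^sub>F t in nhds 0. (\<Sum>i\<in>I. (Y + t *\<^sub>R ?e) $ i * partial_deriv i G (Y + t *\<^sub>R ?e))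
      = G (Y + t *\<^sub>R ?e)"
    using eventually_line_pos_vectors[OF Y] by eventually_elim (rule cpgf_euler[OF G])
  ultimately have "((\<lambda>t. G (Y + t *\<^sub>R ?e)) has_real_derivative
      (\<Sum>i\<in>I. Y $ i * partial_deriv j (partial_deriv i G) Y + ?e $ i * partial_deriv i G Y)) (at 0)"
    by (rule DERIV_transfer_eventually)
  then have "partial_deriv j G Y =
      (\<Sum>i\<in>I. Y $ i * partial_deriv j (partial_deriv i G) Y + ?e $ i * partial_deriv i G Y)"
    by (simp add: partial_deriv_def DERIV_imp_deriv)
  also have "\<dots> = (\<Sum>i\<in>I. Y $ i * partial_deriv j (partial_deriv i G) Y) + partial_deriv j G Y"
    using j by (simp add: sum.distrib axis_def if_distrib[of "\<lambda>x. x * _"] cong: if_cong)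
  finally show "(\<Sum>i\<in>I. Y $ i * partial_deriv j (partial_deriv i G) Y) = 0" by simp
qed

text \<open>\<open>G\<close> is convex, and by homogeneity the tangent plane at \<open>Y\<close> is \<open>Z \<mapsto> \<nabla>G(Y) \<cdot> Z\<close>.\<close>

lemma cpgf_tangent:
  assumes G: "cpgf I G" and Y: "Y \<in> pos_vectors I" and Z: "Z \<in> pos_vectors I"
  shows "(\<Sum>i\<in>I. Z $ i * partial_deriv i G Y) \<le> G Z"
proof -
  define D where "D = (\<chi> i. if i \<in> I then Z $ i - Y $ i else 0)"
  have sumD: "(\<Sum>i\<in>UNIV. D $ i * g i) = (\<Sum>i\<in>I. D $ i * g i)" for g
    by (rule sum.mono_neutral_right) (auto simp: D_def)
  let ?P = "\<lambda>t. Y + t *\<^sub>R D"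
  define C where "C = {t. ?P t \<in> pos_vectors I}"
  have P01: "?P t \<in> pos_vectors I" if "0 \<le> t" "t \<le> 1" for t
  proof -
    have "0 < (1 - t) * Y $ i + t * Z $ i" if "i \<in> I" for i
      using Y Z that \<open>0 \<le> t\<close> \<open>t \<le> 1\<close> unfolding pos_vectors_def
      by (cases "t = 0") (auto intro!: add_nonneg_pos)
    then show ?thesis by (auto simp: pos_vectors_def D_def algebra_simps)
  qed
  \<comment> \<open>The domain is \<open>C\<close> rather than the interval from 0 to 1, because the
    tangent at \<open>t = 0\<close> requires 0 to be an interior point.\<close>
  have "convex C"
    unfolding C_def convex_alt
  proof (intro ballI allI impI, clarsimp simp: pos_vectors_def)
    fix x y u :: real and i
    assume "\<forall>i\<in>I. 0 < Y $ i + x * D $ i" "\<forall>i\<in>I. 0 < Y $ i + y * D $ i" "0 \<le> u" "u \<le> 1" "i \<in> I"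
    then have "0 < (1 - u) * (Y $ i + x * D $ i) + u * (Y $ i + y * D $ i)"
      by (cases "u = 0") (auto intro!: add_nonneg_pos)
    then show "0 < Y $ i + ((1 - u) * x + u * y) * D $ i"
      by (simp add: algebra_simps)
  qed
  have "open C"
  proof -
    have "C = ?P -` pos_vectors I" by (auto simp: C_def)
    then show ?thesis
      by (auto intro!: open_vimage open_pos_vectors continuous_intros)
  qed
  define h where "h t = G (?P t)" for t
  define h' where "h' t = (\<Sum>i\<in>I. D $ i * partial_deriv i G (?P t))" for t
  define h'' where
    "h'' t = (\<Sum>i\<in>I. D $ i * (\<Sum>j\<in>I. D $ j * partial_deriv j (partial_deriv i G) (?P t)))" for t
  have h: "(h has_real_derivative h' t) (at t)" if "t \<in> C" for t
    using has_real_derivative_along_line[of G Y t D] cpgf_partial_derivs(1)[OF G] that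
    unfolding h_def h'_def C_def sumD by blast
  have h': "(h' has_real_derivative h'' t) (at t)" if "t \<in> C" for t
    unfolding h'_def h''_def
  proof (intro DERIV_sum DERIV_cmult)
    fix i assume "i \<in> I"
    then show "((\<lambda>t. partial_deriv i G (?P t)) has_real_derivative
        (\<Sum>j\<in>I. D $ j * partial_deriv j (partial_deriv i G) (?P t))) (at t)"
      using has_real_derivative_along_line[of "partial_deriv i G" Y t D] cpgf_partial_derivs(2)[OF G] that
      unfolding C_def sumD by blast
  qed
  have h'': "h'' t \<ge> 0" if "t \<in> C" for t
  proof -
    let ?Q = "?P t"
    have Q: "?Q \<in> pos_vectors I" using that by (simp add: C_def)
    then have Qpos: "?Q $ i > 0" if "i \<in> I" for i
      using that by (simp add: pos_vectors_def)
    let ?L = "\<lambda>i j. ?Q $ i * ?Q $ j * partial_deriv j (partial_deriv i G) ?Q"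
    \<comment> \<open>Dividing the direction by \<open>?Q $ i\<close> rescales the Hessian to
      \<open>?L\<close>, whose rows and columns sum to zero.\<close>
    have "0 \<le> (\<Sum>i\<in>I. \<Sum>j\<in>I. ?L i j * (D $ i / ?Q $ i) * (D $ j / ?Q $ j))"
    proof (rule quadratic_form_nonneg)
      show "?L i j \<le> 0" if "i \<in> I" "j \<in> I" "i \<noteq> j" for i j
        using cpgf_partial_derivs(4)[OF G Q that(2,1)] that Qpos[OF that(1)] Qpos[OF that(2)]
        by (simp add: mult_pos_neg mult_nonneg_nonpos)
      show "(\<Sum>j\<in>I. ?L i j) = 0" if "i \<in> I" for i
        using cpgf_second_euler(1)[OF G Q that] by (simp add: mult.assoc flip: sum_distrib_left)
      show "(\<Sum>i\<in>I. ?L i j) = 0" if "j \<in> I" for j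
      proof -
        have "(\<Sum>i\<in>I. ?L i j) = ?Q $ j * (\<Sum>i\<in>I. ?Q $ i * partial_deriv j (partial_deriv i G) ?Q)"
          by (simp add: sum_distrib_left mult_ac)
        then show ?thesis using cpgf_second_euler(2)[OF G Q that] by simp
      qed
    qed simp
    also have "\<dots> = (\<Sum>i\<in>I. \<Sum>j\<in>I. D $ i * (D $ j * partial_deriv j (partial_deriv i G) ?Q))"
    proof (intro sum.cong refl)
      fix i j assume "i \<in> I" "j \<in> I"
      with Qpos[of i] Qpos[of j] show "?L i j * (D $ i / ?Q $ i) * (D $ j / ?Q $ j)
          = D $ i * (D $ j * partial_deriv j (partial_deriv i G) ?Q)"
        by (simp add: field_simps del: vector_add_component)
    qed
    also have "\<dots> = h'' t" by (simp add: h''_def sum_distrib_left)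
    finally show ?thesis .
  qed
  have "convex_on C h"
    by (rule f''_ge0_imp_convex[OF \<open>convex C\<close> h h' h''])
  moreover have "0 \<in> C" "1 \<in> C" using P01[of 0] P01[of 1] by (auto simp: C_def)
  \<comment> \<open>The tangent at 0 is evaluated at 1; by Euler's identity \<open>h 0\<close>
    cancels the \<open>Y\<close> part of \<open>h' 0\<close>, which leaves the \<open>Z\<close>
    part.\<close>
  ultimately have "h 1 - h 0 \<ge> h' 0 * (1 - 0)"
    using \<open>open C\<close> \<open>convex C\<close> h[of 0]
    by (intro convex_on_imp_above_tangent[of C h])
      (auto simp: convex_connected interior_open has_field_derivative_at_within)
  moreover have "h 0 = (\<Sum>i\<in>I. Y $ i * partial_deriv i G Y)"
    using cpgf_euler[OF G Y] by (simp add: h_def)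
  moreover have "h' 0 = (\<Sum>i\<in>I. Z $ i * partial_deriv i G Y) - (\<Sum>i\<in>I. Y $ i * partial_deriv i G Y)"
    by (simp add: h'_def D_def sum_subtractf algebra_simps)
  moreover have "h 1 = G Z"
    unfolding h_def by (rule depends_only_onD[OF cpgf_depends_only[OF G] Z]) (simp add: D_def)
  ultimately show ?thesis by simp
qed

section \<open>Convexity in the utilities\<close>

definition exp_vec :: "real^'i::finite \<Rightarrow> real^'i" where
  "exp_vec u = (\<chi> i. exp (u $ i))"

text \<open>The probability of choosing \<open>i\<close>, conditional on choosing within the block of \<open>G\<close>.\<close>

definition share :: "(real^'i::finite \<Rightarrow> real) \<Rightarrow> real^'i \<Rightarrow> 'i \<Rightarrow> real" where
  "share G u i = exp (u $ i) * partial_deriv i G (exp_vec u) / G (exp_vec u)"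

lemma exp_vec_nth [simp]: "exp_vec u $ i = exp (u $ i)"
  by (simp add: exp_vec_def)

lemma exp_vec_pos [simp]: "exp_vec u \<in> pos_vectors I"
  by (simp add: pos_vectors_def)

lemma share_pos:
  assumes "cpgf I G" "i \<in> I"
  shows "share G u i > 0"
  unfolding share_def using assms
  by (intro divide_pos_pos mult_pos_pos cpgf_partial_derivs(3)[OF assms(1)] cpgf_pos[OF assms(1)]) auto

lemma sum_share:
  assumes "cpgf I G" "I \<noteq> {}"
  shows "(\<Sum>i\<in>I. share G u i) = 1"
  using cpgf_euler[OF assms(1) exp_vec_pos, of u] cpgf_pos[OF assms(1) exp_vec_pos assms(2), of u]
  by (simp add: share_def flip: sum_divide_distrib)

lemma cpgf_exp_shift:
  assumes "cpgf I G" "\<And>i. i \<in> I \<Longrightarrow> v $ i = u $ i + k"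
  shows "G (exp_vec v) = exp k * G (exp_vec u)"
proof -
  have "G (exp_vec v) = G (exp k *\<^sub>R exp_vec u)"
    using assms(2)
    by (intro depends_only_onD[OF cpgf_depends_only[OF assms(1)]] pos_vectors_scaleR)
      (auto simp: exp_add)
  then show ?thesis
    using cpgf_homogeneous[OF assms(1) exp_vec_pos] by simp
qed

text \<open>Jensen's inequality for \<open>exp\<close>: the tangent plane of \<open>G\<close> at
  \<open>exp_vec u\<close> bounds \<open>G (exp_vec v)\<close> from below by
  \<open>G (exp_vec u)\<close> times the share-weighted mean of \<open>exp (v $ i - u $ i)\<close>.
  Strictness uses that all shares are positive.\<close>

lemma cpgf_exp_tangent:
  fixes u v :: "real^'i::finite"
  assumes G: "cpgf I G" and I: "I \<noteq> {}"
  defines "\<mu> \<equiv> (\<Sum>i\<in>I. share G u i * (v $ i - u $ i))"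
  shows "G (exp_vec u) * exp \<mu> \<le> G (exp_vec v)"
    and "\<exists>i\<in>I. v $ i - u $ i \<noteq> \<mu> \<Longrightarrow> G (exp_vec u) * exp \<mu> < G (exp_vec v)"
proof -
  let ?d = "\<lambda>i. v $ i - u $ i"
  have G0: "G (exp_vec u) > 0" by (rule cpgf_pos[OF G exp_vec_pos I])
  have "G (exp_vec u) * (\<Sum>i\<in>I. share G u i * exp (?d i))
      = (\<Sum>i\<in>I. exp (v $ i) * partial_deriv i G (exp_vec u))"
    using G0 by (simp add: sum_distrib_left share_def exp_diff mult.commute)
  also have "\<dots> \<le> G (exp_vec v)"
    using cpgf_tangent[OF G exp_vec_pos exp_vec_pos, of v u] by simp
  finally have up: "G (exp_vec u) * (\<Sum>i\<in>I. share G u i * exp (?d i)) \<le> G (exp_vec v)" .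
  \<comment> \<open>The tangent of \<open>exp\<close> at \<open>\<mu>\<close> averages to exactly
    \<open>exp \<mu>\<close>, since the shares sum to 1 and \<open>\<mu>\<close> is the mean
    difference.\<close>
  have "(\<Sum>i\<in>I. share G u i * (exp \<mu> * (1 + (?d i - \<mu>)))) =
      exp \<mu> * ((\<Sum>i\<in>I. share G u i) + (\<Sum>i\<in>I. share G u i * ?d i) - \<mu> * (\<Sum>i\<in>I. share G u i))"
    by (simp add: algebra_simps sum.distrib sum_subtractf sum_distrib_left)
  then have lin: "(\<Sum>i\<in>I. share G u i * (exp \<mu> * (1 + (?d i - \<mu>)))) = exp \<mu>"
    using sum_share[OF G I, of u] by (simp add: \<mu>_def)
  have exp_split: "exp (?d i) = exp \<mu> * exp (?d i - \<mu>)" for i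
    by (simp flip: exp_add)
  have le: "share G u i * (exp \<mu> * (1 + (?d i - \<mu>))) \<le> share G u i * exp (?d i)" if "i \<in> I" for i
    unfolding exp_split[of i]
    using share_pos[OF G that, of u] exp_ge_add_one_self[of "?d i - \<mu>"]
    by (intro mult_left_mono) auto
  have "(\<Sum>i\<in>I. share G u i * (exp \<mu> * (1 + (?d i - \<mu>)))) \<le> (\<Sum>i\<in>I. share G u i * exp (?d i))"
    using le by (rule sum_mono)
  then have "exp \<mu> \<le> (\<Sum>i\<in>I. share G u i * exp (?d i))"
    using lin by simp
  then have "G (exp_vec u) * exp \<mu> \<le> G (exp_vec u) * (\<Sum>i\<in>I. share G u i * exp (?d i))"
    using G0 by (intro mult_left_mono) auto
  also note up
  finally show "G (exp_vec u) * exp \<mu> \<le> G (exp_vec v)" .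
  assume "\<exists>i\<in>I. v $ i - u $ i \<noteq> \<mu>"
  then obtain i where i: "i \<in> I" "?d i \<noteq> \<mu>" by auto
  have "share G u i * (exp \<mu> * (1 + (?d i - \<mu>))) < share G u i * exp (?d i)"
    unfolding exp_split[of i]
    using share_pos[OF G i(1), of u] exp_gt_add_one[of "?d i - \<mu>"] i(2)
    by (intro mult_strict_left_mono) auto
  then have "(\<Sum>i\<in>I. share G u i * (exp \<mu> * (1 + (?d i - \<mu>)))) < (\<Sum>i\<in>I. share G u i * exp (?d i))"
    using i(1) le by (intro sum_strict_mono_ex1) auto
  then have "exp \<mu> < (\<Sum>i\<in>I. share G u i * exp (?d i))"
    using lin by simp
  from mult_strict_left_mono[OF this G0] up
  show "G (exp_vec u) * exp \<mu> < G (exp_vec v)" by simp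
qed

text \<open>Taking logarithms in \<open>cpgf_exp_tangent\<close> gives an affine minorant that
  touches at the intermediate point; its linear terms cancel on averaging.\<close>

lemma ln_cpgf_exp_convex:
  assumes G: "cpgf I G" and I: "I \<noteq> {}"
  shows "convex_on UNIV (\<lambda>u. ln (G (exp_vec u)))"
proof (rule convex_onI)
  fix t :: real and x y :: "real^'a"
  assume t: "0 < t" "t < 1"
  let ?w = "(1 - t) *\<^sub>R x + t *\<^sub>R y"
  let ?T = "\<lambda>v. \<Sum>i\<in>I. share G ?w i * (v $ i - ?w $ i)"
  have tangent: "ln (G (exp_vec ?w)) + ?T v \<le> ln (G (exp_vec v))" for v
  proof -
    have "0 < G (exp_vec ?w) * exp (?T v)"
      using cpgf_pos[OF G exp_vec_pos I] by simp
    from ln_mono[OF cpgf_exp_tangent(1)[OF G I] this]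
    have "ln (G (exp_vec ?w) * exp (?T v)) \<le> ln (G (exp_vec v))" .
    then show ?thesis
      using cpgf_pos[OF G exp_vec_pos I, of ?w] by (simp add: ln_mult)
  qed
  have "(1 - t) * ?T x + t * ?T y = 0"
    by (simp add: sum_distrib_left flip: sum.distrib) (simp add: algebra_simps)
  moreover have "(1 - t) * (ln (G (exp_vec ?w)) + ?T x) + t * (ln (G (exp_vec ?w)) + ?T y)
      \<le> (1 - t) * ln (G (exp_vec x)) + t * ln (G (exp_vec y))"
    using t by (intro add_mono mult_left_mono tangent) auto
  ultimately show "ln (G (exp_vec ?w)) \<le> (1 - t) * ln (G (exp_vec x)) + t * ln (G (exp_vec y))"
    by (simp add: algebra_simps)
qed simp

section \<open>Lower envelopes of affine functions and the equilibrium value\<close>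

text \<open>For a block, \<open>h k - b k * z\<close> is the logarithm of \<open>G\<^sup>n\<close>
  at markup \<open>z\<close> and parameters \<open>k\<close>. A second instance, with
  \<open>h k - ln (b k) - 1\<close> for \<open>h k\<close>, describes the logarithm of the
  best-response value.\<close>

locale affine_family =
  fixes K :: "'k::topological_space set" and h b :: "'k \<Rightarrow> real"
  assumes compact: "compact K" and nonempty: "K \<noteq> {}"
    and cont_h: "continuous_on K h" and cont_b: "continuous_on K b"
    and b_pos: "\<And>k. k \<in> K \<Longrightarrow> b k > 0"
begin

definition lower_env :: "real \<Rightarrow> real" where
  "lower_env z = (INF k\<in>K. h k - b k * z)"

lemma lower_env_attained:
  obtains k where "k \<in> K" "lower_env z = h k - b k * z"
    "\<And>k'. k' \<in> K \<Longrightarrow> h k - b k * z \<le> h k' - b k' * z"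
proof -
  have "continuous_on K (\<lambda>k. h k - b k * z)"
    by (intro continuous_intros cont_h cont_b)
  from continuous_attains_inf[OF compact nonempty this]
  obtain k where k: "k \<in> K" "\<And>k'. k' \<in> K \<Longrightarrow> h k - b k * z \<le> h k' - b k' * z" by auto
  moreover have "lower_env z = h k - b k * z"
    unfolding lower_env_def using k by (intro cInf_eq_minimum) auto
  ultimately show ?thesis using that by blast
qed

lemma lower_env_le: "k \<in> K \<Longrightarrow> lower_env z \<le> h k - b k * z"
  by (metis lower_env_attained)

lemma lower_env_strict_antimono:
  assumes "z < z'"
  shows "lower_env z' < lower_env z"
proof -
  obtain k where k: "k \<in> K" "lower_env z = h k - b k * z" by (metis lower_env_attained)
  then show ?thesis
    using lower_env_le[OF k(1), of z'] b_pos[OF k(1)] assms by (smt (verit) mult_strict_left_mono)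
qed

text \<open>An infimum of affine functions is concave, and a finite concave function on the line is
  continuous.\<close>

lemma lower_env_continuous: "continuous_on UNIV lower_env"
proof -
  have "convex_on UNIV (\<lambda>z. - lower_env z)"
  proof (rule convex_onI)
    fix t x y :: real assume t: "0 < t" "t < 1"
    let ?w = "(1 - t) *\<^sub>R x + t *\<^sub>R y"
    obtain k where k: "k \<in> K" "lower_env ?w = h k - b k * ?w" by (metis lower_env_attained)
    have "(1 - t) * lower_env x + t * lower_env y \<le>
        (1 - t) * (h k - b k * x) + t * (h k - b k * y)"
      using t k(1) by (intro add_mono mult_left_mono lower_env_le) auto
    also have "\<dots> = lower_env ?w" using k(2) by (simp add: algebra_simps)
    finally show "- lower_env ?w \<le> (1 - t) * - lower_env x + t * - lower_env y" by simp
  qed simp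
  then have "continuous_on UNIV (\<lambda>z. - lower_env z)"
    by (rule convex_on_continuous[OF open_UNIV])
  from continuous_on_minus[OF this] show ?thesis by simp
qed

lemma lower_env_bij: "\<exists>!z. lower_env z = s"
proof -
  obtain k0 where k0: "k0 \<in> K" "\<And>k. k \<in> K \<Longrightarrow> h k0 \<le> h k"
    using continuous_attains_inf[OF compact nonempty cont_h] by auto
  obtain k1 where k1: "k1 \<in> K" "\<And>k. k \<in> K \<Longrightarrow> b k1 \<le> b k"
    using continuous_attains_inf[OF compact nonempty cont_b] by auto
  note b1 = b_pos[OF k1(1)]
  \<comment> \<open>At \<open>z1\<close>, which is nonpositive, the smallest \<open>h\<close> and
    the smallest \<open>b\<close> keep every line above \<open>s\<close>; at \<open>z2\<close> the
    line of \<open>k1\<close> has already dropped to \<open>s\<close> or below.\<close>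
  define z1 where "z1 = - (\<bar>s - h k0\<bar> / b k1)"
  define z2 where "z2 = \<bar>s - h k1\<bar> / b k1"
  have "s \<le> lower_env z1"
  proof -
    obtain k where k: "k \<in> K" "lower_env z1 = h k - b k * z1" by (metis lower_env_attained)
    have "b k1 * (- z1) \<le> b k * (- z1)"
      using k1(2)[OF k(1)] b1 by (intro mult_right_mono) (auto simp: z1_def)
    moreover have "b k1 * (- z1) = \<bar>s - h k0\<bar>" using b1 by (simp add: z1_def)
    ultimately show ?thesis using k0(2)[OF k(1)] k(2) by auto
  qed
  moreover have "lower_env z2 \<le> s"
    using lower_env_le[OF k1(1), of z2] b1 by (simp add: z2_def)
  moreover have "z1 \<le> z2"
    using b1 by (auto simp: z1_def z2_def intro: order_trans[of _ 0])
  ultimately have "\<exists>z\<ge>z1. z \<le> z2 \<and> lower_env z = s"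
    using lower_env_continuous by (intro IVT2') (auto intro: continuous_on_subset)
  moreover have "z = z'" if "lower_env z = s" "lower_env z' = s" for z z'
    using that lower_env_strict_antimono[of z z'] lower_env_strict_antimono[of z' z]
    by (cases z z' rule: linorder_cases) auto
  ultimately show ?thesis by blast
qed

end

text \<open>The bound is the maximum of \<open>z \<mapsto> (z - W) exp (h - b z)\<close>, attained at \<open>z = W + 1 / b\<close>.\<close>

lemma markup_bound:
  fixes b g h W z :: real
  assumes b: "b > 0" and g: "0 < g" "g \<le> exp (h - b * z)"
  shows "(z - W) * g \<le> exp (h - b * W - ln b - 1)"
    and "(z - W) * g = exp (h - b * W - ln b - 1) \<Longrightarrow> z = W + 1 / b \<and> g = exp (h - b * z)"
proof -
  let ?T = "exp (h - b * W - ln b - 1)"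
  \<comment> \<open>In the rescaled markup \<open>y\<close> the bound reads
    \<open>y \<le> exp (y - 1)\<close>, an equality only at \<open>y = 1\<close>, that is at
    \<open>z = W + 1 / b\<close>.\<close>
  define y where "y = b * (z - W)"
  have z: "z = W + y / b" using b by (simp add: y_def)
  have T: "?T = exp (h - b * z) * exp (y - 1) / b"
  proof -
    have "h - b * W - ln b - 1 = h - b * z + (y - 1) - ln b"
      using b by (simp add: z algebra_simps)
    then show ?thesis
      by (simp only: exp_diff[of _ "ln b"] exp_add[of _ "y - 1"] exp_ln[OF b])
  qed
  have le: "y \<le> exp (y - 1)" using exp_ge_add_one_self[of "y - 1"] by simp
  \<comment> \<open>Replacing \<open>g\<close> by its upper bound is valid for a positive factor
    \<open>z - W\<close>; otherwise the product is at most 0, below the positive bound.\<close>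
  consider "z \<le> W" | "z > W" by linarith
  then have "(z - W) * g \<le> ?T \<and> ((z - W) * g = ?T \<longrightarrow> z = W + 1 / b \<and> g = exp (h - b * z))"
  proof cases
    case 1
    then have "(z - W) * g \<le> 0" using g(1) by (simp add: mult_nonpos_nonneg)
    also have "0 < ?T" by simp
    finally show ?thesis by simp
  next
    case 2
    then have le1: "(z - W) * g \<le> (z - W) * exp (h - b * z)" using g by (intro mult_left_mono) auto
    have eq: "(z - W) * exp (h - b * z) = exp (h - b * z) * y / b" using b by (simp add: z)
    have le2: "exp (h - b * z) * y / b \<le> ?T"
      unfolding T using le b by (intro divide_right_mono mult_left_mono) auto
    have "z = W + 1 / b \<and> g = exp (h - b * z)" if "(z - W) * g = ?T"
    proof -
      have "y = exp (y - 1)" using that le1 le2 eq b T by (auto simp: field_simps)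
      then have "y = 1" using exp_gt_add_one[of "y - 1"] by auto
      moreover have "(z - W) * g = (z - W) * exp (h - b * z)" using that le1 le2 eq by linarith
      then have "g = exp (h - b * z)" using 2 by simp
      ultimately show ?thesis using z by simp
    qed
    then show ?thesis using le1 le2 eq by auto
  qed
  then show "(z - W) * g \<le> ?T" "(z - W) * g = ?T \<Longrightarrow> z = W + 1 / b \<and> g = exp (h - b * z)" by auto
qed

text \<open>Clearing the positive denominator, as in fractional programming, turns a bound on the
  ratio into a sum with one term per block.\<close>

lemma ratio_le_iff:
  fixes z g :: "'n::finite \<Rightarrow> real"
  assumes "\<And>n. g n > 0"
  shows "(\<Sum>n\<in>UNIV. z n * g n) / (1 + (\<Sum>n\<in>UNIV. g n)) \<le> W \<longleftrightarrow> (\<Sum>n\<in>UNIV. (z n - W) * g n) \<le> W"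
    and "W \<le> (\<Sum>n\<in>UNIV. z n * g n) / (1 + (\<Sum>n\<in>UNIV. g n)) \<longleftrightarrow> W \<le> (\<Sum>n\<in>UNIV. (z n - W) * g n)"
proof -
  have "1 + (\<Sum>n\<in>UNIV. g n) > 0" using assms by (intro add_pos_nonneg sum_nonneg) (auto intro: less_imp_le)
  moreover have "(\<Sum>n\<in>UNIV. (z n - W) * g n) = (\<Sum>n\<in>UNIV. z n * g n) - W * (\<Sum>n\<in>UNIV. g n)"
    by (simp add: algebra_simps sum_subtractf sum_distrib_left)
  ultimately show "(\<Sum>n\<in>UNIV. z n * g n) / (1 + (\<Sum>n\<in>UNIV. g n)) \<le> W \<longleftrightarrow> (\<Sum>n\<in>UNIV. (z n - W) * g n) \<le> W"
    "W \<le> (\<Sum>n\<in>UNIV. z n * g n) / (1 + (\<Sum>n\<in>UNIV. g n)) \<longleftrightarrow> W \<le> (\<Sum>n\<in>UNIV. (z n - W) * g n)"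
    by (auto simp: field_simps)
qed

text \<open>The maxima of the summands add up to exactly \<open>W\<close>, so a ratio equal to
  \<open>W\<close> forces every summand to attain its maximum; \<open>markup_bound\<close> then
  fixes \<open>z n\<close> and \<open>g n\<close>.\<close>

lemma ratio_upper_bound:
  fixes z g h b :: "'n::finite \<Rightarrow> real"
  assumes b: "\<And>n. b n > 0" and g: "\<And>n. 0 < g n" "\<And>n. g n \<le> exp (h n - b n * z n)"
    and W: "(\<Sum>n\<in>UNIV. exp (h n - b n * W - ln (b n) - 1)) = W"
  shows "(\<Sum>n\<in>UNIV. z n * g n) / (1 + (\<Sum>n\<in>UNIV. g n)) \<le> W"
    and "\<exists>n. z n \<noteq> W + 1 / b n \<or> g n \<noteq> exp (h n - b n * z n) \<Longrightarrow>
      (\<Sum>n\<in>UNIV. z n * g n) / (1 + (\<Sum>n\<in>UNIV. g n)) < W"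
proof -
  let ?T = "\<lambda>n. exp (h n - b n * W - ln (b n) - 1)"
  have le: "(z n - W) * g n \<le> ?T n" for n
    by (rule markup_bound(1)[OF b g])
  then have "(\<Sum>n\<in>UNIV. (z n - W) * g n) \<le> (\<Sum>n\<in>UNIV. ?T n)"
    by (rule sum_mono)
  then have "(\<Sum>n\<in>UNIV. (z n - W) * g n) \<le> W"
    using W by simp
  then show "(\<Sum>n\<in>UNIV. z n * g n) / (1 + (\<Sum>n\<in>UNIV. g n)) \<le> W"
    using ratio_le_iff(1)[of g z W] g(1) by simp
  assume "\<exists>n. z n \<noteq> W + 1 / b n \<or> g n \<noteq> exp (h n - b n * z n)"
  then obtain n where "z n \<noteq> W + 1 / b n \<or> g n \<noteq> exp (h n - b n * z n)" by blast
  then have "(z n - W) * g n < ?T n"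
    using le[of n] markup_bound(2)[OF b g, of n W] by fastforce
  with le have "(\<Sum>n\<in>UNIV. (z n - W) * g n) < (\<Sum>n\<in>UNIV. ?T n)"
    by (intro sum_strict_mono_ex1) auto
  then have "\<not> W \<le> (\<Sum>n\<in>UNIV. (z n - W) * g n)" unfolding W by simp
  then show "(\<Sum>n\<in>UNIV. z n * g n) / (1 + (\<Sum>n\<in>UNIV. g n)) < W"
    using ratio_le_iff(2)[of g W z] g(1) by simp
qed

text \<open>At the markups \<open>W + 1 / b n\<close> the factors \<open>1 / b n\<close> are
  positive, so raising \<open>g n\<close> above its nominal value can only raise a summand.\<close>

lemma ratio_lower_bound:
  fixes g h b :: "'n::finite \<Rightarrow> real"
  assumes b: "\<And>n. b n > 0" and g: "\<And>n. exp (h n - b n * (W + 1 / b n)) \<le> g n"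
    and W: "(\<Sum>n\<in>UNIV. exp (h n - b n * W - ln (b n) - 1)) = W"
  shows "W \<le> (\<Sum>n\<in>UNIV. (W + 1 / b n) * g n) / (1 + (\<Sum>n\<in>UNIV. g n))"
proof -
  have "exp (h n - b n * W - ln (b n) - 1) \<le> (W + 1 / b n - W) * g n" for n
  proof -
    have "exp (h n - b n * W - ln (b n) - 1) = 1 / b n * exp (h n - b n * (W + 1 / b n))"
    proof -
      have "h n - b n * W - ln (b n) - 1 = h n - b n * (W + 1 / b n) - ln (b n)"
        using b[of n] by (simp add: algebra_simps)
      then show ?thesis by (simp only: exp_diff[of _ "ln (b n)"] exp_ln[OF b]) simp
    qed
    then show ?thesis using b[of n] g[of n] by (simp add: divide_right_mono)
  qed
  then have "(\<Sum>n\<in>UNIV. exp (h n - b n * W - ln (b n) - 1)) \<le> (\<Sum>n\<in>UNIV. (W + 1 / b n - W) * g n)"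
    by (rule sum_mono)
  moreover have "g n > 0" for n
    using g[of n] by (smt (verit) exp_gt_zero)
  ultimately show ?thesis
    using ratio_le_iff(2)[of g W "\<lambda>n. W + 1 / b n"] W by simp
qed

text \<open>\<open>W\<close> is a fixed point of the sum of the best-response values minimized over
  the \<open>K n\<close>; this sum is continuous and decreasing in \<open>W\<close>.\<close>

lemma exists_equilibrium_value:
  fixes K :: "'n::finite \<Rightarrow> 'k::topological_space set" and h b :: "'n \<Rightarrow> 'k \<Rightarrow> real"
  assumes fam: "\<And>n. affine_family (K n) (h n) (b n)"
  obtains W k where "\<And>n. k n \<in> K n"
    "\<And>n k'. k' \<in> K n \<Longrightarrow>
      h n (k n) - ln (b n (k n)) - b n (k n) * W \<le> h n k' - ln (b n k') - b n k' * W"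
    "(\<Sum>n\<in>UNIV. exp (h n (k n) - b n (k n) * W - ln (b n (k n)) - 1)) = W"
proof -
  let ?h = "\<lambda>n k. h n k - ln (b n k) - 1"
  have fam': "affine_family (K n) (?h n) (b n)" for n
  proof -
    interpret affine_family "K n" "h n" "b n" by (rule fam)
    show ?thesis
      by unfold_locales
        (auto intro!: continuous_intros compact cont_h cont_b nonempty b_pos dest: b_pos)
  qed
  define S where "S W = (\<Sum>n\<in>UNIV. exp (affine_family.lower_env (K n) (?h n) (b n) W))" for W
  have contS: "continuous_on UNIV S"
    unfolding S_def
    by (intro continuous_intros affine_family.lower_env_continuous[OF fam'])
  have S_pos: "S W > 0" for W
    unfolding S_def by (intro sum_pos) auto
  have "S y \<le> S x" if "x < y" for x y
    unfolding S_def using affine_family.lower_env_strict_antimono[OF fam' that]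
    by (intro sum_mono) (auto intro: less_imp_le)
  \<comment> \<open>Provides the sign change: \<open>W - S W\<close> is negative at 0 because
    \<open>S\<close> is positive, and nonnegative at \<open>S 0\<close> by monotonicity.\<close>
  from this[OF S_pos[of 0]] have "S (S 0) \<le> S 0" .
  then have "\<exists>W\<ge>0. W \<le> S 0 \<and> W - S W = 0"
    using S_pos[of 0] by (intro IVT') (auto intro!: continuous_intros continuous_on_subset[OF contS])
  then obtain W where W: "S W = W" by (metis eq_iff_diff_eq_0)
  define Q where "Q n k \<longleftrightarrow> k \<in> K n \<and>
    affine_family.lower_env (K n) (?h n) (b n) W = ?h n k - b n k * W \<and>
    (\<forall>k'\<in>K n. ?h n k - b n k * W \<le> ?h n k' - b n k' * W)" for n k
  have "\<exists>k. Q n k" for n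
    unfolding Q_def by (rule affine_family.lower_env_attained[OF fam'[of n], of W]) blast
  then obtain k where "\<And>n. Q n (k n)" by metis
  then have k: "\<And>n. k n \<in> K n"
      "\<And>n. affine_family.lower_env (K n) (?h n) (b n) W = ?h n (k n) - b n (k n) * W"
      "\<And>n k'. k' \<in> K n \<Longrightarrow> ?h n (k n) - b n (k n) * W \<le> ?h n k' - b n k' * W"
    unfolding Q_def by blast+
  show ?thesis
  proof (rule that[of k W])
    show "h n (k n) - ln (b n (k n)) - b n (k n) * W \<le> h n k' - ln (b n k') - b n k' * W"
      if "k' \<in> K n" for n k'
      using k(3)[OF that] by simp
    show "(\<Sum>n\<in>UNIV. exp (h n (k n) - b n (k n) * W - ln (b n (k n)) - 1)) = W"
      using W unfolding S_def k(2) by (simp add: algebra_simps)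
  qed (rule k(1))
qed

text \<open>First-order condition along the segment from \<open>k\<close> to \<open>k'\<close>: minimizing the best-response value
  over \<open>K\<close> gives a minimizer at the best-response markup.\<close>

lemma minimizer_at_best_response:
  fixes K :: "'k::real_vector set"
  assumes "convex K" "convex_on K h" "linear b" "\<And>k. k \<in> K \<Longrightarrow> b k > 0"
    and k: "k \<in> K" "\<And>k'. k' \<in> K \<Longrightarrow> h k - ln (b k) - b k * W \<le> h k' - ln (b k') - b k' * W"
    and k': "k' \<in> K"
  shows "h k - b k * (W + 1 / b k) \<le> h k' - b k' * (W + 1 / b k)"
proof (rule ccontr)
  \<comment> \<open>By convexity of \<open>h\<close> and linearity of \<open>b\<close>,
    \<open>f\<close> bounds the objective along the segment from above, up to a constant and with
    equality at 0.\<close>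
  define l where "l = h k' - h k - (b k' - b k) * W"
  define f where "f t = t * l - ln (b k + t * (b k' - b k))" for t
  have bk: "b k > 0" using assms(4) k(1) .
  assume "\<not> ?thesis"
  \<comment> \<open>The derivative of \<open>f\<close> at 0 is the right-hand side of the claim
    minus its left-hand side.\<close>
  then have neg: "l - (b k' - b k) / b k < 0"
    using bk by (simp add: l_def algebra_simps diff_divide_distrib)
  have "(f has_real_derivative l - (b k' - b k) / b k) (at 0)"
    unfolding f_def using bk by (auto intro!: derivative_eq_intros)
  from DERIV_neg_dec_right[OF this neg]
  obtain d where d: "d > 0" "\<And>t. 0 < t \<Longrightarrow> t < d \<Longrightarrow> f t < f 0" by auto
  define t where "t = min (d / 2) 1"
  have t: "0 < t" "t \<le> 1" "t < d" using d(1) by (auto simp: t_def)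
  let ?k = "(1 - t) *\<^sub>R k + t *\<^sub>R k'"
  have "?k \<in> K" using assms(1) k(1) k' t by (simp add: convex_alt)
  note min = k(2)[OF this]
  have h_le: "h ?k \<le> (1 - t) * h k + t * h k'"
    using convex_onD[OF assms(2), of t k k'] k(1) k' t by simp
  have b_eq: "b ?k = b k + t * (b k' - b k)"
    by (simp add: linear_add[OF assms(3)] linear_scale[OF assms(3)]) (simp add: algebra_simps)
  have "h k - ln (b k) - b k * W \<le>
      (1 - t) * h k + t * h k' - ln (b k + t * (b k' - b k)) - (b k + t * (b k' - b k)) * W"
    using min h_le unfolding b_eq by linarith
  then have "f 0 \<le> f t"
    unfolding f_def l_def by (simp add: algebra_simps)
  with d(2)[OF t(1,3)] show False by simp
qed

section \<open>Convexity of relative entropy\<close>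

lemma mult_ln_ratio_tangent:
  fixes p P r R :: real
  assumes "p > 0" "P > 0" "r > 0" "R > 0"
  shows "p * ln (r / R) + p - P * (r / R) \<le> p * ln (p / P)"
    and "p / P \<noteq> r / R \<Longrightarrow> p * ln (r / R) + p - P * (r / R) < p * ln (p / P)"
proof -
  let ?y = "(r / R) / (p / P)"
  have y: "?y > 0" using assms by simp
  have ln: "ln ?y = ln (r / R) - ln (p / P)" using assms by (subst ln_div) auto
  have py: "p * ?y = P * (r / R)" using assms by (simp add: field_simps)
  \<comment> \<open>The left-hand side of the claim is the tangent plane of
    \<open>p * ln (p / P)\<close> at \<open>(r, R)\<close>. It lies below the function because
    \<open>ln ?y \<le> ?y - 1\<close>, with equality only at \<open>?y = 1\<close>.\<close>
  have "p * ln ?y \<le> p * (?y - 1)"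
    using ln_le_minus_one[OF y] assms by (intro mult_left_mono) auto
  then show "p * ln (r / R) + p - P * (r / R) \<le> p * ln (p / P)"
    unfolding ln right_diff_distrib py by simp
  assume "p / P \<noteq> r / R"
  then have "?y \<noteq> 1" by (metis divide_eq_1_iff)
  then have "ln ?y < ?y - 1" using ln_le_minus_one[OF y] ln_eq_minus_one[OF y] by fastforce
  then have "p * ln ?y < p * (?y - 1)" using assms by (intro mult_strict_left_mono) auto
  then show "p * ln (r / R) + p - P * (r / R) < p * ln (p / P)"
    unfolding ln right_diff_distrib py by simp
qed

text \<open>The tangent planes at \<open>(r, R)\<close>, taken at both end points, average to
  \<open>r * ln (r / R)\<close>. The function is linear along rays, so strictness requires a change
  of ratio.\<close>

lemma mult_ln_ratio_convex:
  fixes p q P Q t :: real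
  assumes pos: "p > 0" "q > 0" "P > 0" "Q > 0" and t: "0 < t" "t < 1"
  defines "r \<equiv> (1 - t) * p + t * q" and "R \<equiv> (1 - t) * P + t * Q"
  shows "r * ln (r / R) \<le> (1 - t) * (p * ln (p / P)) + t * (q * ln (q / Q))"
    and "p / P \<noteq> r / R \<Longrightarrow> r * ln (r / R) < (1 - t) * (p * ln (p / P)) + t * (q * ln (q / Q))"
proof -
  have r: "r > 0" "R > 0" unfolding r_def R_def using pos t by (auto intro!: add_pos_pos)
  let ?a = "p * ln (r / R) + p - P * (r / R)" and ?b = "q * ln (r / R) + q - Q * (r / R)"
  have "(1 - t) * (p * l + p - P * s) + t * (q * l + q - Q * s) = r * l + r - R * s" for l s
    unfolding r_def R_def by (simp add: algebra_simps)
  from this[of "ln (r / R)" "r / R"] have eq: "(1 - t) * ?a + t * ?b = r * ln (r / R)" using r by simp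
  have b: "t * ?b \<le> t * (q * ln (q / Q))"
    using t mult_ln_ratio_tangent(1)[OF pos(2,4) r] by (intro mult_left_mono) auto
  have "(1 - t) * ?a \<le> (1 - t) * (p * ln (p / P))"
    using t mult_ln_ratio_tangent(1)[OF pos(1,3) r] by (intro mult_left_mono) auto
  with b show "r * ln (r / R) \<le> (1 - t) * (p * ln (p / P)) + t * (q * ln (q / Q))"
    unfolding eq[symmetric] by linarith
  assume "p / P \<noteq> r / R"
  then have "(1 - t) * ?a < (1 - t) * (p * ln (p / P))"
    using t mult_ln_ratio_tangent(2)[OF pos(1,3) r] by (intro mult_strict_left_mono) auto
  with b show "r * ln (r / R) < (1 - t) * (p * ln (p / P)) + t * (q * ln (q / Q))"
    unfolding eq[symmetric] by linarith
qed

section \<open>The robust pricing problem\<close>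

lemma cpgf_continuous_on_exp:
  assumes "cpgf I G" "continuous_on S f"
  shows "continuous_on S (\<lambda>x. G (exp_vec (f x)))"
    and "i \<in> I \<Longrightarrow> continuous_on S (\<lambda>x. partial_deriv i G (exp_vec (f x)))"
proof -
  have "continuous_on S (\<lambda>x. exp_vec (f x))"
    unfolding exp_vec_def by (intro continuous_intros assms(2))
  moreover have "(\<lambda>x. exp_vec (f x)) ` S \<subseteq> pos_vectors I" by auto
  moreover have "continuous_on (pos_vectors I) G"
    using cpgf_partial_derivs(1)[OF assms(1)]
    by (auto intro!: continuous_at_imp_continuous_on differentiable_imp_continuous_within)
  moreover have "continuous_on (pos_vectors I) (partial_deriv i G)" if "i \<in> I"
    using cpgf_partial_derivs(2)[OF assms(1) _ that]
    by (auto intro!: continuous_at_imp_continuous_on differentiable_imp_continuous_within)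
  ultimately show "continuous_on S (\<lambda>x. G (exp_vec (f x)))"
    and "i \<in> I \<Longrightarrow> continuous_on S (\<lambda>x. partial_deriv i G (exp_vec (f x)))"
    using continuous_on_compose2[of "pos_vectors I" _ S "\<lambda>x. exp_vec (f x)"] by simp_all
qed

lemma attains_min_compact:
  assumes "compact S" "S \<noteq> {}" "continuous_on S f"
  shows "attains_min f S"
  using continuous_attains_inf[OF assms] by (auto simp: attains_min_def is_arg_min_linorder)

definition utility :: "real^'i::finite \<Rightarrow> 'i params \<Rightarrow> real^'i" where
  "utility x ab = (\<chi> i. fst ab $ i - snd ab $ i * x $ i)"

lemma price_Y_eq: "price_Y x ab = exp_vec (utility x ab)"
  by (simp add: price_Y_def exp_vec_def utility_def)

lemma markup_G_eq_exp_vec: "markup_G Gn c z ab = Gn (exp_vec (utility (\<chi> i. z + c $ i) ab))"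
  by (simp add: markup_G_def exp_vec_def utility_def)

lemma continuous_on_utility: "continuous_on S (utility x)"
  unfolding utility_def by (intro continuous_intros)

lemma continuous_on_markup_G:
  assumes "cpgf I Gn"
  shows "continuous_on S (markup_G Gn c z)"
  unfolding markup_G_eq_exp_vec
  by (intro cpgf_continuous_on_exp[OF assms] continuous_on_utility)

lemma fst_restrict_params [simp]: "fst (restrict_params I ab) $ i = (if i \<in> I then fst ab $ i else 0)"
  and snd_restrict_params [simp]: "snd (restrict_params I ab) $ i = (if i \<in> I then snd ab $ i else 0)"
  by (simp_all add: restrict_params_def)

lemma params_eqI:
  assumes "\<And>i. fst ab $ i = fst ab' $ i" "\<And>i. snd ab $ i = snd ab' $ i"
  shows "ab = (ab' :: 'i::finite params)"
  using assms by (simp add: prod_eq_iff vec_eq_iff)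

lemma markup_G_restrict:
  assumes "cpgf I Gn"
  shows "markup_G Gn c z (restrict_params I ab) = markup_G Gn c z ab"
  unfolding markup_G_eq_exp_vec
  by (intro depends_only_onD[OF cpgf_depends_only[OF assms] exp_vec_pos]) (simp add: utility_def)

text \<open>The uncertainty sets are a parameter, so that the results can be instantiated again with
  singletons, as \<open>revenue_attains_max\<close> does.\<close>

locale robust_pricing =
  fixes V :: "'n::finite \<Rightarrow> 'i::finite set"
    and G :: "'n \<Rightarrow> real^'i \<Rightarrow> real"
    and c :: "real^'i"
    and A :: "'n \<Rightarrow> ('i params) set"
  assumes V_nonempty: "V n \<noteq> {}" and V_disjoint: "disjoint_family V" and V_cover: "(\<Union>n. V n) = UNIV"
    and cpgf: "cpgf (V n) (G n)"
    and A_block: "A n \<subseteq> block_params (V n)"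
    and A_nonempty: "A n \<noteq> {}" and A_convex: "convex (A n)" and A_compact: "compact (A n)"
    and A_sens: "\<forall>(a, b)\<in>A n. (\<forall>i\<in>V n. b $ i > 0) \<and> (\<forall>i\<in>V n. \<forall>j\<in>V n. b $ i = b $ j)"
begin

text \<open>Reading off one fixed coordinate of the block makes \<open>sens n\<close> linear on all
  parameters; on \<open>A n\<close> it is the common sensitivity.\<close>

definition sens :: "'n \<Rightarrow> 'i params \<Rightarrow> real" where
  "sens n ab = snd ab $ (SOME i. i \<in> V n)"

definition pot :: "'n \<Rightarrow> 'i params \<Rightarrow> real" where
  "pot n ab = ln (markup_G (G n) c 0 ab)"

definition homogeneous :: "'n \<Rightarrow> 'i params \<Rightarrow> bool" where
  "homogeneous n ab \<longleftrightarrow> sens n ab > 0 \<and> (\<forall>i\<in>V n. snd ab $ i = sens n ab)"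

definition block :: "'i \<Rightarrow> 'n" where
  "block i = (THE n. i \<in> V n)"

lemma some_in_V: "(SOME i. i \<in> V n) \<in> V n"
  using V_nonempty by (simp add: some_in_eq)

lemma V_unique: "i \<in> V n \<Longrightarrow> i \<in> V m \<Longrightarrow> n = m"
  using V_disjoint by (auto simp: disjoint_family_on_def)

lemma block_eq: "i \<in> V n \<Longrightarrow> block i = n"
  unfolding block_def using V_unique by blast

lemma in_block: "i \<in> V (block i)"
proof -
  obtain n where "i \<in> V n" using V_cover by blast
  then show ?thesis by (simp add: block_eq)
qed

lemma sum_blocks: "(\<Sum>i\<in>UNIV. f i) = (\<Sum>n\<in>UNIV. \<Sum>i\<in>V n. f i)" for f :: "'i \<Rightarrow> real"
  unfolding V_cover[symmetric] using V_disjoint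
  by (intro sum.UNION_disjoint) (auto simp: disjoint_family_on_def)

lemma A_homogeneous:
  assumes "ab \<in> A n"
  shows "homogeneous n ab"
proof -
  have "\<forall>i\<in>V n. snd ab $ i > 0" "\<forall>i\<in>V n. \<forall>j\<in>V n. snd ab $ i = snd ab $ j"
    using bspec[OF A_sens assms] unfolding case_prod_beta by blast+
  with some_in_V[of n] show ?thesis
    unfolding homogeneous_def sens_def by blast
qed

lemma sens_restrict [simp]: "sens n (restrict_params (V n) ab) = sens n ab"
  by (simp add: sens_def some_in_V)

lemma pot_restrict [simp]: "pot n (restrict_params (V n) ab) = pot n ab"
  by (simp add: pot_def markup_G_restrict[OF cpgf])

lemma homogeneous_restrict [simp]: "homogeneous n (restrict_params (V n) ab) \<longleftrightarrow> homogeneous n ab"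
  by (simp add: homogeneous_def)

lemma product_set_homogeneous: "ab \<in> product_set V A \<Longrightarrow> homogeneous n ab"
  using A_homogeneous[of "restrict_params (V n) ab" n] by (simp add: product_set_def)

lemma markup_G_pos: "markup_G (G n) c z ab > 0"
  unfolding markup_G_eq_exp_vec by (rule cpgf_pos[OF cpgf exp_vec_pos V_nonempty])

text \<open>A markup \<open>z\<close> lowers all utilities of the block by the same amount
  \<open>sens n ab * z\<close>, which homogeneity turns into a factor.\<close>

lemma markup_G_homogeneous:
  assumes "homogeneous n ab"
  shows "markup_G (G n) c z ab = exp (pot n ab - sens n ab * z)"
proof -
  have "markup_G (G n) c z ab = exp (- (sens n ab * z)) * markup_G (G n) c 0 ab"
    unfolding markup_G_eq_exp_vec using assms
    by (intro cpgf_exp_shift[OF cpgf]) (auto simp: utility_def homogeneous_def algebra_simps)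
  then show ?thesis
    using markup_G_pos[of n 0 ab] by (simp add: pot_def exp_diff exp_minus field_simps)
qed

lemma A_family: "affine_family (A n) (pot n) (sens n)"
proof
  show "continuous_on (A n) (pot n)"
    unfolding pot_def using markup_G_pos[of n 0]
    by (intro continuous_intros continuous_on_markup_G[OF cpgf]) (auto simp: less_le)
  show "continuous_on (A n) (sens n)"
    unfolding sens_def by (intro continuous_intros)
qed (use A_compact A_nonempty A_homogeneous in \<open>auto simp: homogeneous_def\<close>)

lemma linear_sens: "linear (sens n)"
  by (rule linearI) (simp_all add: sens_def)

lemma convex_pot: "convex_on (A n) (pot n)"
proof (rule convex_onI)
  fix t :: real and x y :: "'i params" assume t: "0 < t" "t < 1"
  have "utility (\<chi> i. 0 + c $ i) ((1 - t) *\<^sub>R x + t *\<^sub>R y) =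
      (1 - t) *\<^sub>R utility (\<chi> i. 0 + c $ i) x + t *\<^sub>R utility (\<chi> i. 0 + c $ i) y"
    by (simp add: vec_eq_iff utility_def algebra_simps)
  then show "pot n ((1 - t) *\<^sub>R x + t *\<^sub>R y) \<le> (1 - t) * pot n x + t * pot n y"
    unfolding pot_def markup_G_eq_exp_vec
    using convex_onD[OF ln_cpgf_exp_convex[OF cpgf V_nonempty], of t] t by simp
qed (rule A_convex)

section \<open>Assembling full parameters from blocks\<close>

lemma restrict_sum:
  assumes "\<And>n. k n \<in> A n"
  shows "restrict_params (V m) (\<Sum>n\<in>UNIV. k n) = k m"
proof -
  have zero: "fst (k n) $ i = 0 \<and> snd (k n) $ i = 0" if "i \<notin> V n" for n i
    using A_block[of n] assms[of n] that by (cases "k n") (auto simp: block_params_def)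
  have "(\<Sum>n\<in>UNIV. f (k n)) = f (k m)"
    if "i \<in> V m" "\<And>n. i \<notin> V n \<Longrightarrow> f (k n) = 0" for i and f :: "'i params \<Rightarrow> real"
  proof -
    have "(\<Sum>n\<in>UNIV. f (k n)) = (\<Sum>n\<in>{m}. f (k n))"
      by (rule sum.mono_neutral_right) (use that V_unique in auto)
    then show ?thesis by simp
  qed
  note this[of _ "\<lambda>ab. fst ab $ _"] this[of _ "\<lambda>ab. snd ab $ _"]
  then show ?thesis
    using zero by (intro params_eqI) (auto simp: fst_sum snd_sum)
qed

lemma sum_in_product_set:
  assumes "\<And>n. k n \<in> A n"
  shows "(\<Sum>n\<in>UNIV. k n) \<in> product_set V A"
  using assms by (simp add: product_set_def restrict_sum[OF assms])

lemma sum_restrict: "(\<Sum>n\<in>UNIV. restrict_params (V n) ab) = ab"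
proof -
  have "(\<Sum>n\<in>UNIV. if i \<in> V n then r else 0) = r" for i and r :: real
  proof -
    have "(\<Sum>n\<in>UNIV. if i \<in> V n then r else 0) = (\<Sum>n\<in>UNIV. if n = block i then r else 0)"
      using in_block block_eq by (intro sum.cong) auto
    then show ?thesis by simp
  qed
  then show ?thesis by (intro params_eqI) (simp_all add: fst_sum snd_sum)
qed

lemma product_set_nonempty: "product_set V A \<noteq> {}"
  using sum_in_product_set[of "\<lambda>n. SOME ab. ab \<in> A n"] A_nonempty by (auto simp: some_in_eq)

lemma product_set_compact: "compact (product_set V A)"
proof (rule compact_eq_bounded_closed[THEN iffD2], rule conjI)
  obtain B where B: "\<And>n ab. ab \<in> A n \<Longrightarrow> norm ab \<le> B n"
    using compact_imp_bounded[OF A_compact] unfolding bounded_iff by metis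
  show "bounded (product_set V A)"
    unfolding bounded_iff
  proof (intro exI ballI)
    fix ab assume "ab \<in> product_set V A"
    then have "norm (restrict_params (V n) ab) \<le> B n" for n
      by (intro B) (simp add: product_set_def)
    then have "norm (\<Sum>n\<in>UNIV. restrict_params (V n) ab) \<le> (\<Sum>n\<in>UNIV. B n)"
      by (intro sum_norm_le)
    then show "norm ab \<le> (\<Sum>n\<in>UNIV. B n)" by (simp add: sum_restrict)
  qed
  have cont: "continuous_on UNIV (\<lambda>ab. if i \<in> I then f ab else 0)" if "continuous_on UNIV f"
    for f :: "'i params \<Rightarrow> real" and i I using that by (cases "i \<in> I") auto
  have "continuous_on UNIV (restrict_params (V n))" for n
    unfolding restrict_params_def by (intro continuous_intros cont)
  then have "closed (\<Inter>n. restrict_params (V n) -` A n)"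
    by (intro closed_INT ballI closed_vimage compact_imp_closed[OF A_compact])
  also have "(\<Inter>n. restrict_params (V n) -` A n) = product_set V A"
    by (auto simp: product_set_def)
  finally show "closed (product_set V A)" .
qed

section \<open>Revenue at arbitrary prices\<close>

lemma partial_deriv_total_G:
  assumes "i \<in> V n"
  shows "partial_deriv i (total_G G) (exp_vec u) = partial_deriv i (G n) (exp_vec u)"
proof -
  have "partial_deriv i (total_G G) (exp_vec u) = (\<Sum>m\<in>UNIV. partial_deriv i (G m) (exp_vec u))"
    unfolding total_G_def[abs_def] by (rule partial_deriv_sum) (rule cpgf_partial_derivs(1)[OF cpgf exp_vec_pos])
  also have "\<dots> = (\<Sum>m\<in>{n}. partial_deriv i (G m) (exp_vec u))"
  proof (rule sum.mono_neutral_right)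
    show "\<forall>m\<in>UNIV - {n}. partial_deriv i (G m) (exp_vec u) = 0"
      using V_unique[OF assms]
      by (auto intro!: partial_deriv_outside[OF cpgf_depends_only[OF cpgf] exp_vec_pos])
  qed auto
  finally show ?thesis by simp
qed

lemma total_G_pos: "total_G G (exp_vec u) > 0"
  unfolding total_G_def by (intro sum_pos cpgf_pos[OF cpgf exp_vec_pos V_nonempty]) auto

lemma continuous_on_revenue: "continuous_on S (revenue G c x)"
proof -
  have "continuous_on S (\<lambda>ab. exp_vec (utility x ab) $ i * partial_deriv i (total_G G) (exp_vec (utility x ab)) /
      (1 + total_G G (exp_vec (utility x ab))))" for i
  proof (intro continuous_on_divide continuous_on_mult continuous_on_add continuous_on_const ballI)
    show "continuous_on S (\<lambda>ab. exp_vec (utility x ab) $ i)"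
      by (simp, intro continuous_intros continuous_on_utility)
    show "continuous_on S (\<lambda>ab. partial_deriv i (total_G G) (exp_vec (utility x ab)))"
      unfolding partial_deriv_total_G[OF in_block]
      by (intro cpgf_continuous_on_exp(2)[OF cpgf continuous_on_utility in_block])
    show "continuous_on S (\<lambda>ab. total_G G (exp_vec (utility x ab)))"
      unfolding total_G_def
      by (intro continuous_intros cpgf_continuous_on_exp(1)[OF cpgf continuous_on_utility])
    show "1 + total_G G (exp_vec (utility x ab)) \<noteq> 0" for ab
      using total_G_pos[of "utility x ab"] by linarith
  qed
  then show ?thesis
    unfolding revenue_def choice_prob_def Let_def price_Y_eq
    by (intro continuous_on_sum continuous_on_mult_left)
qed

lemma continuous_on_markup_revenue: "continuous_on S (markup_revenue G c z)"
  unfolding markup_revenue_def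
proof (intro continuous_intros ballI continuous_on_markup_G[OF cpgf])
  fix ab
  have "(\<Sum>n\<in>UNIV. markup_G (G n) c (z $ n) ab) > 0"
    by (intro sum_pos markup_G_pos) auto
  then show "1 + (\<Sum>n\<in>UNIV. markup_G (G n) c (z $ n) ab) \<noteq> 0" by linarith
qed

definition avg_markup :: "real^'i \<Rightarrow> 'i params \<Rightarrow> 'n \<Rightarrow> real" where
  "avg_markup x ab n = (\<Sum>i\<in>V n. share (G n) (utility x ab) i * (x $ i - c $ i))"

text \<open>Within a block, \<open>choice_prob\<close> is \<open>share\<close> times the probability
  of choosing the block, so the individual markups combine to their share-weighted mean.\<close>

lemma revenue_eq:
  "revenue G c x ab = (\<Sum>n\<in>UNIV. avg_markup x ab n * G n (exp_vec (utility x ab))) /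
     (1 + (\<Sum>n\<in>UNIV. G n (exp_vec (utility x ab))))"
proof -
  let ?u = "utility x ab"
  let ?T = "1 + total_G G (exp_vec ?u)"
  have "revenue G c x ab = (\<Sum>n\<in>UNIV. \<Sum>i\<in>V n. (x $ i - c $ i) * choice_prob G x ab i)"
    unfolding revenue_def by (rule sum_blocks)
  also have "\<dots> = (\<Sum>n\<in>UNIV. \<Sum>i\<in>V n. share (G n) ?u i * (x $ i - c $ i) * G n (exp_vec ?u) / ?T)"
  proof (intro sum.cong refl)
    fix n i assume "i \<in> V n"
    then show "(x $ i - c $ i) * choice_prob G x ab i =
        share (G n) ?u i * (x $ i - c $ i) * G n (exp_vec ?u) / ?T"
      using cpgf_pos[OF cpgf exp_vec_pos V_nonempty, of n ?u]
      by (simp add: choice_prob_def Let_def price_Y_eq partial_deriv_total_G share_def)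
  qed
  also have "\<dots> = (\<Sum>n\<in>UNIV. avg_markup x ab n * G n (exp_vec ?u)) / ?T"
    by (simp add: avg_markup_def sum_divide_distrib sum_distrib_right)
  finally show ?thesis by (simp add: total_G_def)
qed

text \<open>The utilities under \<open>x\<close> are compared with those under the constant markup
  \<open>z\<close>: their differences have share-weighted mean zero, so the exponent in
  \<open>cpgf_exp_tangent\<close> vanishes.\<close>

lemma avg_markup_bound:
  fixes x :: "real^'i"
  assumes "homogeneous n ab"
  defines "z \<equiv> avg_markup x ab n"
  shows "G n (exp_vec (utility x ab)) \<le> exp (pot n ab - sens n ab * z)"
    and "\<exists>i\<in>V n. x $ i - c $ i \<noteq> z \<Longrightarrow> G n (exp_vec (utility x ab)) < exp (pot n ab - sens n ab * z)"
proof -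
  let ?u = "utility x ab" and ?v = "utility (\<chi> i. z + c $ i) ab"
  have diff: "?v $ i - ?u $ i = sens n ab * (x $ i - c $ i - z)" if "i \<in> V n" for i
    using assms(1) that by (simp add: utility_def homogeneous_def algebra_simps)
  have "(\<Sum>i\<in>V n. share (G n) ?u i * (?v $ i - ?u $ i)) =
      (\<Sum>i\<in>V n. sens n ab * (share (G n) ?u i * (x $ i - c $ i)) - sens n ab * z * share (G n) ?u i)"
    by (intro sum.cong refl) (simp add: diff algebra_simps)
  also have "\<dots> = sens n ab * z - sens n ab * z * (\<Sum>i\<in>V n. share (G n) ?u i)"
    by (simp add: sum_subtractf z_def avg_markup_def flip: sum_distrib_left)
  finally have mu: "(\<Sum>i\<in>V n. share (G n) ?u i * (?v $ i - ?u $ i)) = 0"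
    using sum_share[OF cpgf V_nonempty, of n ?u] by simp
  have v: "G n (exp_vec ?v) = exp (pot n ab - sens n ab * z)"
    using markup_G_homogeneous[OF assms(1), of z] by (simp add: markup_G_eq_exp_vec)
  show "G n (exp_vec ?u) \<le> exp (pot n ab - sens n ab * z)"
    using cpgf_exp_tangent(1)[OF cpgf V_nonempty, of n ?u ?v] unfolding mu v by simp
  assume "\<exists>i\<in>V n. x $ i - c $ i \<noteq> z"
  then have "\<exists>i\<in>V n. ?v $ i - ?u $ i \<noteq> 0"
    using diff assms(1) by (auto simp: homogeneous_def)
  then show "G n (exp_vec ?u) < exp (pot n ab - sens n ab * z)"
    using cpgf_exp_tangent(2)[OF cpgf[of n] V_nonempty, where u = ?u and v = ?v] unfolding mu v by simp
qed

definition block_prices :: "real^'n \<Rightarrow> real^'i" where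
  "block_prices z = (\<chi> i. z $ block i + c $ i)"

lemma revenue_block_prices: "revenue G c (block_prices z) ab = markup_revenue G c z ab"
proof -
  have "avg_markup (block_prices z) ab n = z $ n" for n
    unfolding avg_markup_def using sum_share[OF cpgf V_nonempty, of n "utility (block_prices z) ab"]
    by (simp add: block_prices_def block_eq flip: sum_distrib_right)
  moreover have "G n (exp_vec (utility (block_prices z) ab)) = markup_G (G n) c (z $ n) ab" for n
    unfolding markup_G_eq_exp_vec
    by (intro depends_only_onD[OF cpgf_depends_only[OF cpgf] exp_vec_pos])
      (simp add: utility_def block_prices_def block_eq)
  ultimately show ?thesis by (simp add: revenue_eq markup_revenue_def)
qed

end

text \<open>\<open>ys\<close> caps every \<open>x\<close> at \<open>w\<close>, strictly unless
  \<open>x = xs\<close>, while \<open>xs\<close> guarantees \<open>w\<close>. Attainment supplies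
  the bounds without which \<open>INF\<close> and \<open>SUP\<close> of real functions carry no
  information.\<close>

lemma strict_saddle_point:
  fixes f :: "'x \<Rightarrow> 'y \<Rightarrow> real"
  assumes ys: "ys \<in> S" and up: "f xs ys \<le> w" "\<And>x. x \<noteq> xs \<Longrightarrow> f x ys < w"
    and low: "\<And>y. y \<in> S \<Longrightarrow> w \<le> f xs y"
    and amin: "\<And>x. attains_min (f x) S"
  shows "unique_maximizer (\<lambda>x. INF y\<in>S. f x y) UNIV xs"
    and "saddle_point f UNIV S xs ys"
    and "(SUP x. INF y\<in>S. f x y) = w"
    and "(\<And>y. y \<in> S \<Longrightarrow> attains_max (\<lambda>x. f x y) UNIV) \<Longrightarrow>
      attains_min (\<lambda>y. SUP x. f x y) S \<and> (INF y\<in>S. SUP x. f x y) = w"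
proof -
  have w: "f xs ys = w" using up(1) low[OF ys] by simp
  have le: "f x ys \<le> w" for x using up by (cases "x = xs") (auto intro: less_imp_le)
  have bdd: "bdd_below (f x ` S)" for x
  proof -
    obtain y where "\<And>y'. y' \<in> S \<Longrightarrow> f x y \<le> f x y'"
      using amin[of x] by (auto simp: attains_min_def is_arg_min_linorder)
    then show ?thesis by (intro bdd_belowI2)
  qed
  have INF_le: "(INF y\<in>S. f x y) \<le> f x ys" for x by (rule cINF_lower[OF bdd ys])
  have INF_xs: "(INF y\<in>S. f xs y) = w"
    using w ys low by (intro cInf_eq_minimum) auto
  have INF_less: "(INF y\<in>S. f x y) < w" if "x \<noteq> xs" for x
    using INF_le[of x] up(2)[OF that] by linarith
  show "unique_maximizer (\<lambda>x. INF y\<in>S. f x y) UNIV xs"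
    unfolding unique_maximizer_def is_arg_max_def using INF_xs INF_less by (metis UNIV_I less_asym)
  show "saddle_point f UNIV S xs ys"
    unfolding saddle_point_def using ys w le low by auto
  have "(INF y\<in>S. f x y) \<le> w" for x
    using INF_le[of x] le[of x] by linarith
  then show "(SUP x. INF y\<in>S. f x y) = w"
    using INF_xs by (intro cSup_eq_maximum) auto
  assume amax: "\<And>y. y \<in> S \<Longrightarrow> attains_max (\<lambda>x. f x y) UNIV"
  have SUP_ge: "w \<le> (SUP x. f x y)" if y: "y \<in> S" for y
  proof -
    obtain x where "f x' y \<le> f x y" for x'
      using amax[OF y] by (auto simp: attains_max_def is_arg_max_def not_less)
    then have "bdd_above (range (\<lambda>x. f x y))" by (intro bdd_aboveI2)
    then have "f xs y \<le> (SUP x. f x y)" by (intro cSUP_upper) auto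
    with low[OF y] show ?thesis by linarith
  qed
  have SUP_ys: "(SUP x. f x ys) = w"
    using w le by (intro cSup_eq_maximum) auto
  have "is_arg_min (\<lambda>y. SUP x. f x y) (\<lambda>y. y \<in> S) ys"
    unfolding is_arg_min_linorder SUP_ys using ys SUP_ge by simp
  moreover have "(INF y\<in>S. SUP x. f x y) = w"
    using SUP_ys SUP_ge ys by (intro cInf_eq_minimum) auto
  ultimately show "attains_min (\<lambda>y. SUP x. f x y) S \<and> (INF y\<in>S. SUP x. f x y) = w"
    unfolding attains_min_def by blast
qed

section \<open>The equilibrium of seller and adversary\<close>

context robust_pricing
begin

lemma worst_params_iff:
  "worst_params (G n) c (A n) z ab \<longleftrightarrow>
     ab \<in> A n \<and> (\<forall>ab'\<in>A n. pot n ab - sens n ab * z \<le> pot n ab' - sens n ab' * z)"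
proof -
  have "markup_G (G n) c z ab \<le> markup_G (G n) c z ab' \<longleftrightarrow>
      pot n ab - sens n ab * z \<le> pot n ab' - sens n ab' * z" if "ab \<in> A n" "ab' \<in> A n" for ab ab'
    using that by (simp add: markup_G_homogeneous[OF A_homogeneous])
  then show ?thesis
    unfolding worst_params_def is_arg_min_linorder by blast
qed

text \<open>The summands are the maxima over \<open>z\<close> of \<open>(z - W) G\<^sup>n(z)\<close> at the parameters \<open>ab\<close>, so that \<open>W\<close> is
  the maximal revenue at \<open>ab\<close>.\<close>

definition equilibrium :: "real \<Rightarrow> 'i params \<Rightarrow> bool" where
  "equilibrium W ab \<longleftrightarrow> ab \<in> product_set V A \<and>
     (\<Sum>n\<in>UNIV. exp (pot n ab - sens n ab * W - ln (sens n ab) - 1)) = W \<and>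
     (\<forall>n. worst_params (G n) c (A n) (W + 1 / sens n ab) (restrict_params (V n) ab))"

text \<open>The markups at which the bound of \<open>markup_bound\<close> is attained for the
  parameters \<open>ab\<close>.\<close>

definition best_markup :: "real \<Rightarrow> 'i params \<Rightarrow> real^'n" where
  "best_markup W ab = (\<chi> n. W + 1 / sens n ab)"

text \<open>\<open>exists_equilibrium_value\<close> supplies block parameters that minimize the
  best-response value; by \<open>minimizer_at_best_response\<close> they are also the worst case at
  the best-response markup.\<close>

lemma exists_equilibrium: "\<exists>W ab. equilibrium W ab"
proof -
  obtain W k where k: "\<And>n. k n \<in> A n"
    "\<And>n k'. k' \<in> A n \<Longrightarrow>
      pot n (k n) - ln (sens n (k n)) - sens n (k n) * W \<le> pot n k' - ln (sens n k') - sens n k' * W"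
    "(\<Sum>n\<in>UNIV. exp (pot n (k n) - sens n (k n) * W - ln (sens n (k n)) - 1)) = W"
    by (rule exists_equilibrium_value[where K = A and h = pot and b = sens, OF A_family]) blast
  define ab where "ab = (\<Sum>n\<in>UNIV. k n)"
  have restr: "restrict_params (V n) ab = k n" for n
    unfolding ab_def by (rule restrict_sum[OF k(1)])
  have sens: "sens n ab = sens n (k n)" and pot: "pot n ab = pot n (k n)" for n
    using sens_restrict[of n ab] pot_restrict[of n ab] by (simp_all add: restr)
  have "worst_params (G n) c (A n) (W + 1 / sens n (k n)) (k n)" for n
    unfolding worst_params_iff
    using minimizer_at_best_response[OF A_convex convex_pot linear_sens _ k(1,2)] k(1)
      A_homogeneous by (auto simp: homogeneous_def)
  then have "equilibrium W ab"
    unfolding equilibrium_def sens pot restr using k(3) sum_in_product_set[OF k(1)]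
    by (auto simp: ab_def)
  then show ?thesis by blast
qed

context
  fixes W ab
  assumes eq: "equilibrium W ab"
begin

lemma equilibrium_sens_pos: "sens n ab > 0"
  using product_set_homogeneous[of ab n] eq by (simp add: equilibrium_def homogeneous_def)

lemma equilibrium_value: "(\<Sum>n\<in>UNIV. exp (pot n ab - sens n ab * W - ln (sens n ab) - 1)) = W"
  using eq by (simp add: equilibrium_def)

text \<open>Averaged markups reduce arbitrary prices to \<open>ratio_upper_bound\<close>. Other
  prices lose strictly: either some block average is not optimal, or markups vary within a block and
  \<open>avg_markup_bound\<close> is strict.\<close>

lemma revenue_upper:
  "revenue G c x ab \<le> W"
  "x \<noteq> block_prices (best_markup W ab) \<Longrightarrow> revenue G c x ab < W"
proof -
  have hom: "homogeneous n ab" for n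
    using eq by (simp add: equilibrium_def product_set_homogeneous)
  have pos: "G n (exp_vec (utility x ab)) > 0" for n
    by (rule cpgf_pos[OF cpgf exp_vec_pos V_nonempty])
  note bounds = ratio_upper_bound[of "\<lambda>n. sens n ab" "\<lambda>n. G n (exp_vec (utility x ab))"
      "\<lambda>n. pot n ab" "avg_markup x ab", OF equilibrium_sens_pos pos avg_markup_bound(1)[OF hom]
      equilibrium_value]
  show "revenue G c x ab \<le> W" unfolding revenue_eq by (rule bounds(1))
  assume "x \<noteq> block_prices (best_markup W ab)"
  then obtain i where "x $ i \<noteq> best_markup W ab $ block i + c $ i"
    by (auto simp: vec_eq_iff block_prices_def)
  then have "avg_markup x ab (block i) \<noteq> W + 1 / sens (block i) ab \<or>
      x $ i - c $ i \<noteq> avg_markup x ab (block i)"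
    by (auto simp: best_markup_def)
  then have "avg_markup x ab (block i) \<noteq> W + 1 / sens (block i) ab \<or>
      G (block i) (exp_vec (utility x ab)) \<noteq>
        exp (pot (block i) ab - sens (block i) ab * avg_markup x ab (block i))"
    using avg_markup_bound(2)[OF hom, of "block i" x] in_block[of i] by fastforce
  then show "revenue G c x ab < W"
    unfolding revenue_eq by (intro bounds(2)) blast
qed

lemma markup_revenue_upper:
  "markup_revenue G c z ab \<le> W"
  "z \<noteq> best_markup W ab \<Longrightarrow> markup_revenue G c z ab < W"
proof -
  show "markup_revenue G c z ab \<le> W"
    using revenue_upper(1)[of "block_prices z"] by (simp add: revenue_block_prices)
  assume "z \<noteq> best_markup W ab"
  then obtain n where n: "z $ n \<noteq> best_markup W ab $ n" by (auto simp: vec_eq_iff)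
  obtain i where "i \<in> V n" using V_nonempty by blast
  with n have "block_prices z $ i \<noteq> block_prices (best_markup W ab) $ i"
    by (simp add: block_prices_def block_eq)
  then have "block_prices z \<noteq> block_prices (best_markup W ab)" by auto
  from revenue_upper(2)[OF this] show "markup_revenue G c z ab < W"
    by (simp add: revenue_block_prices)
qed

lemma worst_at_equilibrium:
  assumes "ab' \<in> A n"
  shows "pot n ab - sens n ab * (W + 1 / sens n ab) \<le> pot n ab' - sens n ab' * (W + 1 / sens n ab)"
proof -
  have "worst_params (G n) c (A n) (W + 1 / sens n ab) (restrict_params (V n) ab)"
    using eq by (simp add: equilibrium_def)
  with assms show ?thesis
    unfolding worst_params_iff by simp
qed

text \<open>At the best markups each block of \<open>ab\<close> is a worst case, so other parameters
  do not lower any \<open>G\<^sup>n\<close>, and \<open>ratio_lower_bound\<close> applies.\<close>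

lemma markup_revenue_ge:
  assumes "ab' \<in> product_set V A"
  shows "W \<le> markup_revenue G c (best_markup W ab) ab'"
proof -
  have "exp (pot n ab - sens n ab * (W + 1 / sens n ab)) \<le> markup_G (G n) c (W + 1 / sens n ab) ab'" for n
    using worst_at_equilibrium[of "restrict_params (V n) ab'" n] assms
    by (simp add: markup_G_homogeneous[OF product_set_homogeneous[OF assms]] product_set_def)
  from ratio_lower_bound[of "\<lambda>n. sens n ab" "\<lambda>n. pot n ab" W, OF equilibrium_sens_pos this equilibrium_value]
  show ?thesis by (simp add: markup_revenue_def best_markup_def)
qed

end

text \<open>For fixed parameters the pricing problem is the robust problem with singleton
  uncertainty sets, and its equilibrium prices are a maximizer.\<close>

lemma revenue_attains_max:
  assumes "ab \<in> product_set V A"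
  shows "attains_max (\<lambda>x. revenue G c x ab) UNIV"
proof -
  have sub: "restrict_params (V n) ab \<in> A n" for n using assms by (simp add: product_set_def)
  interpret single: robust_pricing V G c "\<lambda>n. {restrict_params (V n) ab}"
    using bspec[OF A_sens sub] subsetD[OF A_block sub]
    by unfold_locales (simp_all add: V_nonempty V_disjoint V_cover cpgf)
  obtain W ab' where eq: "single.equilibrium W ab'" using single.exists_equilibrium by blast
  have "restrict_params (V n) ab' = restrict_params (V n) ab" for n
    using eq by (simp add: single.equilibrium_def product_set_def)
  then have "ab' = ab" using sum_restrict[of ab] sum_restrict[of ab'] by simp
  with eq have eq: "single.equilibrium W ab" by simp
  have "ab \<in> product_set V (\<lambda>n. {restrict_params (V n) ab})" by (simp add: product_set_def)
  from single.markup_revenue_ge[OF eq this]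
  have "W \<le> revenue G c (block_prices (single.best_markup W ab)) ab"
    by (simp add: revenue_block_prices)
  then show ?thesis
    unfolding attains_max_def is_arg_max_def using single.revenue_upper(1)[OF eq]
    by (meson UNIV_I leD order_trans)
qed

section \<open>Choice probabilities as variables and the convex program\<close>

definition log_lower :: "'n \<Rightarrow> real \<Rightarrow> real" where
  "log_lower n = affine_family.lower_env (A n) (pot n) (sens n)"

lemma log_lower_attained:
  obtains ab where "ab \<in> A n" "log_lower n z = pot n ab - sens n ab * z"
  unfolding log_lower_def by (rule affine_family.lower_env_attained[OF A_family]) blast

lemma log_lower_le: "ab \<in> A n \<Longrightarrow> log_lower n z \<le> pot n ab - sens n ab * z"
  unfolding log_lower_def by (rule affine_family.lower_env_le[OF A_family])

lemma log_lower_bij: "\<exists>!z. log_lower n z = s"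
  unfolding log_lower_def by (rule affine_family.lower_env_bij[OF A_family])

lemma lower_G_eq: "lower_G (G n) c (A n) z = exp (log_lower n z)"
proof -
  obtain ab where ab: "ab \<in> A n" "log_lower n z = pot n ab - sens n ab * z"
    by (rule log_lower_attained)
  have "markup_G (G n) c z ab' = exp (pot n ab' - sens n ab' * z)" if "ab' \<in> A n" for ab'
    by (rule markup_G_homogeneous[OF A_homogeneous[OF that]])
  then show ?thesis
    unfolding lower_G_def using ab log_lower_le[of _ n z] by (intro cInf_eq_minimum) auto
qed

text \<open>The envelope \<open>exp (log_lower n z)\<close> lies below \<open>G\<^sup>n\<close> at
  the equilibrium parameters and touches it at the best markup, so both ratio bounds apply.\<close>

lemma lower_revenue_upper:
  assumes eq: "equilibrium W ab"
  shows "lower_revenue G c A (best_markup W ab) = W"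
    and "z \<noteq> best_markup W ab \<Longrightarrow> lower_revenue G c A z < W"
proof -
  have restr: "restrict_params (V n) ab \<in> A n" for n
    using eq by (simp add: equilibrium_def product_set_def)
  have le: "exp (log_lower n z) \<le> exp (pot n ab - sens n ab * z)" for n z
    using log_lower_le[OF restr, of n z] by simp
  have upper: "lower_revenue G c A z \<le> W"
    "\<exists>n. z $ n \<noteq> W + 1 / sens n ab \<Longrightarrow> lower_revenue G c A z < W" for z
    unfolding lower_revenue_def lower_G_eq
    using ratio_upper_bound[of "\<lambda>n. sens n ab" "\<lambda>n. exp (log_lower n (z $ n))" "\<lambda>n. pot n ab"
      "\<lambda>n. z $ n", OF equilibrium_sens_pos[OF eq] exp_gt_zero le equilibrium_value[OF eq]] by blast+
  have "exp (pot n ab - sens n ab * (W + 1 / sens n ab)) \<le> exp (log_lower n (W + 1 / sens n ab))" for n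
  proof -
    obtain ab' where "ab' \<in> A n"
        "log_lower n (W + 1 / sens n ab) = pot n ab' - sens n ab' * (W + 1 / sens n ab)"
      by (rule log_lower_attained)
    with worst_at_equilibrium[OF eq] show ?thesis by simp
  qed
  from ratio_lower_bound[of "\<lambda>n. sens n ab" "\<lambda>n. pot n ab" W, OF equilibrium_sens_pos[OF eq] this
      equilibrium_value[OF eq]]
  have "W \<le> lower_revenue G c A (best_markup W ab)"
    by (simp add: lower_revenue_def lower_G_eq best_markup_def)
  with upper(1)[of "best_markup W ab"] show "lower_revenue G c A (best_markup W ab) = W"
    by linarith
  assume "z \<noteq> best_markup W ab"
  then obtain n where "z $ n \<noteq> W + 1 / sens n ab" by (auto simp: vec_eq_iff best_markup_def)
  then show "lower_revenue G c A z < W" by (intro upper(2)) blast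
qed

lemma has_probs_open_simplex:
  assumes "has_probs G c A p z"
  shows "p \<in> open_simplex"
proof -
  let ?S = "\<Sum>n\<in>UNIV. exp (log_lower n (z $ n))"
  have S: "?S \<ge> 0" by (intro sum_nonneg) auto
  have p: "p $ n = exp (log_lower n (z $ n)) / (1 + ?S)" for n
    using assms by (simp add: has_probs_def lower_G_eq)
  then have "(\<Sum>n\<in>UNIV. p $ n) = ?S / (1 + ?S)"
    by (simp flip: sum_divide_distrib)
  then show ?thesis
    using p S by (simp add: open_simplex_def add_nonneg_pos add_pos_nonneg)
qed

text \<open>One minus the sum of \<open>p\<close> is the no-purchase probability, the reciprocal of
  the common denominator. Dividing by it decouples the system into one scalar equation per
  block.\<close>

lemma has_probs_iff:
  assumes "p \<in> open_simplex"
  shows "has_probs G c A p z \<longleftrightarrow> (\<forall>n. log_lower n (z $ n) = ln (p $ n / (1 - (\<Sum>n\<in>UNIV. p $ n))))"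
proof -
  let ?S = "\<Sum>n\<in>UNIV. exp (log_lower n (z $ n))" and ?p0 = "1 - (\<Sum>n\<in>UNIV. p $ n)"
  have p: "p $ n > 0" for n
    using assms by (simp add: open_simplex_def)
  have p0: "?p0 > 0"
    using assms by (simp add: open_simplex_def)
  show ?thesis
  proof
    assume "has_probs G c A p z"
    then have eq: "p $ n = exp (log_lower n (z $ n)) / (1 + ?S)" for n
      by (simp add: has_probs_def lower_G_eq)
    have S: "1 + ?S > 0" by (intro add_pos_nonneg sum_nonneg) auto
    have "(\<Sum>n\<in>UNIV. p $ n) = ?S / (1 + ?S)"
      by (simp add: eq flip: sum_divide_distrib)
    then have "?p0 = 1 / (1 + ?S)" using S by (simp add: field_simps)
    then have "p $ n / ?p0 = exp (log_lower n (z $ n))" for n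
      using eq[of n] S by simp
    then show "\<forall>n. log_lower n (z $ n) = ln (p $ n / ?p0)" by simp
  next
    assume "\<forall>n. log_lower n (z $ n) = ln (p $ n / ?p0)"
    then have eq: "exp (log_lower n (z $ n)) = p $ n / ?p0" for n
      using p[of n] p0 by simp
    then have "1 + ?S = 1 / ?p0"
      using p0 by (simp flip: sum_divide_distrib) (simp add: field_simps)
    then show "has_probs G c A p z"
      using p0 by (simp add: has_probs_def lower_G_eq eq)
  qed
qed

lemma has_probs_unique:
  assumes "p \<in> open_simplex"
  shows "\<exists>!z. has_probs G c A p z"
proof -
  let ?s = "\<lambda>n. ln (p $ n / (1 - (\<Sum>n\<in>UNIV. p $ n)))"
  define f where "f n = (THE z. log_lower n z = ?s n)" for n
  have f: "log_lower n z = ?s n \<longleftrightarrow> z = f n" for n z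
    unfolding f_def using theI'[OF log_lower_bij] log_lower_bij by metis
  show ?thesis
    unfolding has_probs_iff[OF assms] f by (rule ex1I[of _ "\<chi> n. f n"]) (auto simp: vec_eq_iff)
qed

lemma has_probs_markup_of_probs:
  "p \<in> open_simplex \<Longrightarrow> has_probs G c A p (markup_of_probs G c A p)"
  unfolding markup_of_probs_def by (rule theI'[OF has_probs_unique])

lemma markup_of_probs_eqI: "has_probs G c A p z \<Longrightarrow> markup_of_probs G c A p = z"
  using has_probs_markup_of_probs has_probs_unique has_probs_open_simplex by metis

lemma exists_probs: "\<exists>p. has_probs G c A p z"
  by (rule exI[of _ "\<chi> n. lower_G (G n) c (A n) (z $ n) / (1 + (\<Sum>l\<in>UNIV. lower_G (G l) c (A l) (z $ l)))"])
    (simp add: has_probs_def)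

lemma has_probs_inj: "has_probs G c A p z \<Longrightarrow> has_probs G c A q z \<Longrightarrow> p = q"
  by (simp add: has_probs_def vec_eq_iff)

lemma lower_revenue_probs:
  assumes "has_probs G c A p z"
  shows "lower_revenue G c A z = (\<Sum>n\<in>UNIV. p $ n * z $ n)"
  using assms by (simp add: has_probs_def lower_revenue_def sum_divide_distrib mult.commute)

lemma convex_open_simplex: "convex (open_simplex :: (real^'n) set)"
  unfolding convex_alt
proof (intro ballI allI impI)
  fix p q :: "real^'n" and t :: real
  assume pq: "p \<in> open_simplex" "q \<in> open_simplex" and t: "0 \<le> t \<and> t \<le> 1"
  have pos: "0 < (1 - t) * x + t * y" if "x > 0" "y > 0" for x y :: real
    using that t by (cases "t = 0") (auto intro!: add_nonneg_pos)
  have "(\<Sum>n\<in>UNIV. ((1 - t) *\<^sub>R p + t *\<^sub>R q) $ n) = (1 - t) * (\<Sum>n\<in>UNIV. p $ n) + t * (\<Sum>n\<in>UNIV. q $ n)"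
    by (simp add: sum.distrib sum_distrib_left)
  then have "1 - (\<Sum>n\<in>UNIV. ((1 - t) *\<^sub>R p + t *\<^sub>R q) $ n) =
      (1 - t) * (1 - (\<Sum>n\<in>UNIV. p $ n)) + t * (1 - (\<Sum>n\<in>UNIV. q $ n))"
    by (simp add: algebra_simps)
  also have "\<dots> > 0"
    using pq by (intro pos) (auto simp: open_simplex_def)
  finally show "(1 - t) *\<^sub>R p + t *\<^sub>R q \<in> open_simplex"
    using pq pos by (simp add: open_simplex_def)
qed

text \<open>Since \<open>z\<^sub>n(p) = min (pot - ln (p\<^sub>n / p\<^sub>0)) / sens\<close> over the uncertainty set, the revenue
  \<open>\<Sum> p\<^sub>n z\<^sub>n(p)\<close> is a minimum of functions that are concave by the log-sum inequality.\<close>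

lemma strictly_concave_revenue:
  "strictly_concave_on open_simplex (\<lambda>p. lower_revenue G c A (markup_of_probs G c A p))"
  unfolding strictly_concave_on_def
proof (intro conjI ballI impI allI convex_open_simplex)
  fix p q :: "real^'n" and t :: real
  assume pq: "p \<in> open_simplex" "q \<in> open_simplex" "p \<noteq> q" and "0 < t \<and> t < 1"
  then have t: "0 < t" "t < 1" by auto
  define r where "r = (1 - t) *\<^sub>R p + t *\<^sub>R q"
  have r: "r \<in> open_simplex"
    using convexD[OF convex_open_simplex pq(1,2), of "1 - t" t] t by (simp add: r_def)
  let ?z = "markup_of_probs G c A"
  define slack :: "real^'n \<Rightarrow> real" where "slack p = 1 - (\<Sum>n\<in>UNIV. p $ n)" for p
  have pos: "p $ n > 0" "slack p > 0" if "p \<in> open_simplex" for p :: "real^'n" and n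
    using that by (auto simp: open_simplex_def slack_def)
  have slack_r: "slack r = (1 - t) * slack p + t * slack q"
    by (simp add: slack_def r_def sum.distrib algebra_simps sum_distrib_left sum_subtractf)
  have z: "log_lower n (?z p $ n) = ln (p $ n / slack p)" if "p \<in> open_simplex" for p :: "real^'n" and n
    using has_probs_markup_of_probs[OF that] has_probs_iff[OF that] by (simp add: slack_def)
  have rev: "lower_revenue G c A (?z p) = (\<Sum>n\<in>UNIV. p $ n * ?z p $ n)"
    if "p \<in> open_simplex" for p :: "real^'n"
    by (rule lower_revenue_probs[OF has_probs_markup_of_probs[OF that]])
  have concave: "(1 - t) * (p $ n * ?z p $ n) + t * (q $ n * ?z q $ n) \<le> r $ n * ?z r $ n \<and>
      (p $ n / slack p \<noteq> r $ n / slack r \<longrightarrow>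
        (1 - t) * (p $ n * ?z p $ n) + t * (q $ n * ?z q $ n) < r $ n * ?z r $ n)" for n
  proof -
    \<comment> \<open>\<open>k\<close> is a worst case at the markup belonging to \<open>r\<close>:
      it gives an equation at \<open>r\<close> and inequalities at \<open>p\<close> and
      \<open>q\<close>, so one pair \<open>s\<close>, \<open>h\<close> serves all three
      points.\<close>
    obtain k where k: "k \<in> A n" "log_lower n (?z r $ n) = pot n k - sens n k * ?z r $ n"
      by (rule log_lower_attained)
    define s h where "s = sens n k" and "h = pot n k"
    have s: "s > 0" using A_homogeneous[OF k(1)] by (simp add: s_def homogeneous_def)
    have zr: "s * ?z r $ n = h - ln (r $ n / slack r)"
      using k(2) z[OF r, of n] by (simp add: s_def h_def)
    have zle: "s * ?z p $ n \<le> h - ln (p $ n / slack p)" if "p \<in> open_simplex" for p :: "real^'n"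
      using log_lower_le[OF k(1), of "?z p $ n"] z[OF that, of n] by (simp add: s_def h_def)
    have step: "w * (p $ n * (s * ?z p $ n)) \<le> w * (p $ n * h) - w * (p $ n * ln (p $ n / slack p))"
      if "p \<in> open_simplex" "w > 0" for p :: "real^'n" and w
    proof -
      have "w * (p $ n * (s * ?z p $ n)) \<le> w * (p $ n * (h - ln (p $ n / slack p)))"
        using zle[OF that(1)] pos(1)[OF that(1), of n] that(2) by (intro mult_left_mono) auto
      then show ?thesis by (simp add: right_diff_distrib)
    qed
    have rn: "r $ n = (1 - t) * p $ n + t * q $ n" by (simp add: r_def)
    have eq: "s * (r $ n * ?z r $ n) = (1 - t) * (p $ n * h) + t * (q $ n * h) - r $ n * ln (r $ n / slack r)"
    proof -
      have "s * (r $ n * ?z r $ n) = r $ n * (s * ?z r $ n)" by simp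
      also have "\<dots> = r $ n * h - r $ n * ln (r $ n / slack r)"
        unfolding zr by (rule right_diff_distrib)
      finally show ?thesis by (simp add: rn algebra_simps)
    qed
    have eq': "s * ((1 - t) * (p $ n * ?z p $ n) + t * (q $ n * ?z q $ n)) =
        (1 - t) * (p $ n * (s * ?z p $ n)) + t * (q $ n * (s * ?z q $ n))"
      by (simp add: algebra_simps)
    note steps = step[OF pq(1), of "1 - t"] step[OF pq(2), of t]
    note conv = mult_ln_ratio_convex[OF pos(1)[OF pq(1), of n] pos(1)[OF pq(2), of n]
        pos(2)[OF pq(1)] pos(2)[OF pq(2)] t, folded rn slack_r]
    have "s * ((1 - t) * (p $ n * ?z p $ n) + t * (q $ n * ?z q $ n)) \<le> s * (r $ n * ?z r $ n)"
      unfolding eq eq' using steps conv(1) t by linarith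
    moreover have "s * ((1 - t) * (p $ n * ?z p $ n) + t * (q $ n * ?z q $ n)) < s * (r $ n * ?z r $ n)"
      if "p $ n / slack p \<noteq> r $ n / slack r"
      unfolding eq eq' using steps conv(2)[OF that] t by linarith
    ultimately show ?thesis using s by simp
  qed
  \<comment> \<open>If all ratios agreed, \<open>p\<close> and \<open>r\<close> would be
    proportional together with their slacks. The total of 1 then makes them equal, which forces
    \<open>p = q\<close>.\<close>
  have "\<exists>n. p $ n / slack p \<noteq> r $ n / slack r"
  proof (rule ccontr)
    assume "\<not> ?thesis"
    then have ratio: "p $ n = slack p / slack r * r $ n" for n
      using pos(2)[OF pq(1)] pos(2)[OF r] by (simp add: field_simps)
    have total: "(\<Sum>n\<in>UNIV. p $ n) = 1 - slack p" for p by (simp add: slack_def)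
    have "(\<Sum>n\<in>UNIV. p $ n) = (\<Sum>n\<in>UNIV. slack p / slack r * r $ n)"
      by (rule sum.cong[OF refl ratio])
    then have "1 - slack p = slack p / slack r * (1 - slack r)"
      unfolding sum_distrib_left[symmetric] total .
    then have "slack p = slack r"
      using pos(2)[OF pq(1)] pos(2)[OF r] by (simp add: field_simps)
    then have "p $ n = r $ n" for n using ratio[of n] pos(2)[OF r] by simp
    then have "p = r" by (simp add: vec_eq_iff)
    then have "t *\<^sub>R p = t *\<^sub>R q" by (simp add: r_def algebra_simps)
    then show False using t pq(3) by simp
  qed
  then have "(\<Sum>n\<in>UNIV. (1 - t) * (p $ n * ?z p $ n) + t * (q $ n * ?z q $ n)) < (\<Sum>n\<in>UNIV. r $ n * ?z r $ n)"
    using concave by (intro sum_strict_mono_ex1) auto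
  then show "(1 - t) * lower_revenue G c A (?z p) + t * lower_revenue G c A (?z q)
      < lower_revenue G c A (?z ((1 - t) *\<^sub>R p + t *\<^sub>R q))"
    using rev[OF pq(1)] rev[OF pq(2)] rev[OF r]
    by (simp add: sum.distrib sum_distrib_left flip: r_def)
qed

text \<open>Passing from probabilities to markups is injective, so the strict optimality of the best
  markups among all \<open>z\<close> carries over to the simplex.\<close>

lemma unique_maximizer_probs:
  assumes eq: "equilibrium W ab"
  shows "\<exists>ps. unique_maximizer (\<lambda>p. lower_revenue G c A (markup_of_probs G c A p)) open_simplex ps \<and>
    best_markup W ab = markup_of_probs G c A ps"
proof -
  obtain ps where ps: "has_probs G c A ps (best_markup W ab)" using exists_probs by blast
  have ps_in: "ps \<in> open_simplex" by (rule has_probs_open_simplex[OF ps])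
  have z: "markup_of_probs G c A ps = best_markup W ab" by (rule markup_of_probs_eqI[OF ps])
  have less: "lower_revenue G c A (markup_of_probs G c A p) < W" if "p \<in> open_simplex" "p \<noteq> ps" for p
  proof (rule lower_revenue_upper(2)[OF eq])
    show "markup_of_probs G c A p \<noteq> best_markup W ab"
      using has_probs_markup_of_probs[OF that(1)] has_probs_inj[OF ps] that(2) by metis
  qed
  then have "unique_maximizer (\<lambda>p. lower_revenue G c A (markup_of_probs G c A p)) open_simplex ps"
    unfolding unique_maximizer_def is_arg_max_def
    using ps_in lower_revenue_upper(1)[OF eq] z by (metis less_asym)
  with z show ?thesis by metis
qed

lemma worst_params_at_eq:
  assumes "\<forall>n. \<exists>!ab. worst_params (G n) c (A n) (z $ n) ab"
    and "\<And>n. worst_params (G n) c (A n) (z $ n) (restrict_params (V n) ab)"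
  shows "worst_params_at G c A z = ab"
proof -
  have "(THE ab. worst_params (G n) c (A n) (z $ n) ab) = restrict_params (V n) ab" for n
    using assms by (intro the1_equality) auto
  then show ?thesis by (simp add: worst_params_at_def sum_restrict)
qed

end

theorem theorem4:
  fixes V :: "'n::finite \<Rightarrow> 'i::finite set"
    and G :: "'n \<Rightarrow> real^'i \<Rightarrow> real"
    and c :: "real^'i"
    and A :: "'n \<Rightarrow> ('i params) set"
  assumes "\<forall>n. V n \<noteq> {}" and "disjoint_family V" and "(\<Union>n. V n) = UNIV"
    and "\<forall>n. cpgf (V n) (G n)"
    and "\<forall>n. A n \<subseteq> block_params (V n)"
    and "\<forall>n. A n \<noteq> {}" and "\<forall>n. convex (A n)" and "\<forall>n. compact (A n)"
    and "\<forall>n. \<forall>(a, b)\<in>A n. (\<forall>i\<in>V n. b $ i > 0) \<and> (\<forall>i\<in>V n. \<forall>j\<in>V n. b $ i = b $ j)"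
  shows
    "\<exists>xs :: real^'i. \<exists>zs :: real^'n.
       \<comment> \<open>the robust problem and its unique solution\<close>
       (\<forall>x. attains_min (revenue G c x) (product_set V A)) \<and>
       unique_maximizer (\<lambda>x. INF ab\<in>product_set V A. revenue G c x ab) UNIV xs \<and>
       \<comment> \<open>the markup problem and its unique solution\<close>
       (\<forall>z. attains_min (markup_revenue G c z) (product_set V A)) \<and>
       unique_maximizer (\<lambda>z. INF ab\<in>product_set V A. markup_revenue G c z ab) UNIV zs \<and>
       (\<forall>n. \<forall>i\<in>V n. xs $ i = zs $ n + c $ i) \<and>
       \<comment> \<open>the markup problem as a convex program in \<open>p\<close>\<close>
       (\<forall>n z. attains_min (markup_G (G n) c z) (A n)) \<and>
       (\<forall>p\<in>open_simplex. \<exists>!z. has_probs G c A p z) \<and>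
       strictly_concave_on open_simplex (\<lambda>p. lower_revenue G c A (markup_of_probs G c A p)) \<and>
       (\<exists>ps. unique_maximizer (\<lambda>p. lower_revenue G c A (markup_of_probs G c A p)) open_simplex ps \<and>
          zs = markup_of_probs G c A ps) \<and>
       \<comment> \<open>saddle point\<close>
       (\<exists>ab. (\<forall>n. worst_params (G n) c (A n) (zs $ n) (restrict_params (V n) ab)) \<and>
          saddle_point (revenue G c) UNIV (product_set V A) xs ab) \<and>
       ((\<forall>n. \<exists>!ab. worst_params (G n) c (A n) (zs $ n) ab) \<longrightarrow>
          saddle_point (revenue G c) UNIV (product_set V A) xs (worst_params_at G c A zs)) \<and>
       \<comment> \<open>minimax equality\<close>
       (\<forall>ab\<in>product_set V A. attains_max (\<lambda>x. revenue G c x ab) UNIV) \<and>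
       attains_min (\<lambda>ab. SUP x. revenue G c x ab) (product_set V A) \<and>
       (SUP x. INF ab\<in>product_set V A. revenue G c x ab) =
         (INF ab\<in>product_set V A. SUP x. revenue G c x ab)"
proof -
  interpret robust_pricing V G c A
    by unfold_locales (use assms in simp_all)
  obtain W ab where eq: "equilibrium W ab" using exists_equilibrium by blast
  let ?S = "product_set V A"
  define zs where "zs = best_markup W ab"
  define xs where "xs = block_prices zs"
  have ab: "ab \<in> ?S" and worst: "\<And>n. worst_params (G n) c (A n) (zs $ n) (restrict_params (V n) ab)"
    using eq by (simp_all add: equilibrium_def zs_def best_markup_def)
  have min_x: "attains_min (revenue G c x) ?S" for x
    by (intro attains_min_compact product_set_compact product_set_nonempty continuous_on_revenue)
  have min_z: "attains_min (markup_revenue G c z) ?S" for z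
    by (intro attains_min_compact product_set_compact product_set_nonempty continuous_on_markup_revenue)
  have low: "W \<le> revenue G c xs ab'" if "ab' \<in> ?S" for ab'
    using markup_revenue_ge[OF eq that] by (simp add: xs_def zs_def revenue_block_prices)
  \<comment> \<open>Prices and block markups are two instances of the same minimax argument, with
    common adversary parameters \<open>ab\<close> and common value \<open>W\<close>.\<close>
  note saddle_x = strict_saddle_point[of ab ?S "revenue G c" xs W,
      OF ab revenue_upper(1)[OF eq] revenue_upper(2)[OF eq, folded zs_def, folded xs_def] low min_x]
  note saddle_z = strict_saddle_point[of ab ?S "markup_revenue G c" zs W,
      OF ab markup_revenue_upper(1)[OF eq] markup_revenue_upper(2)[OF eq, folded zs_def]
        markup_revenue_ge[OF eq, folded zs_def] min_z]
  show ?thesis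
  proof (rule exI[of _ xs], rule exI[of _ zs], intro conjI allI ballI impI)
    show "xs $ i = zs $ n + c $ i" if "i \<in> V n" for n i
      using that by (simp add: xs_def block_prices_def block_eq)
    show "attains_min (markup_G (G n) c z) (A n)" for n z
      by (intro attains_min_compact A_compact A_nonempty continuous_on_markup_G[OF cpgf])
    show "\<exists>ab. (\<forall>n. worst_params (G n) c (A n) (zs $ n) (restrict_params (V n) ab)) \<and>
        saddle_point (revenue G c) UNIV ?S xs ab"
      using worst saddle_x(2) by blast
    show "saddle_point (revenue G c) UNIV ?S xs (worst_params_at G c A zs)"
      if "\<forall>n. \<exists>!ab. worst_params (G n) c (A n) (zs $ n) ab"
      using saddle_x(2) worst_params_at_eq[OF that worst] by simp
    show "(SUP x. INF ab\<in>?S. revenue G c x ab) = (INF ab\<in>?S. SUP x. revenue G c x ab)"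
      "attains_min (\<lambda>ab. SUP x. revenue G c x ab) ?S"
      using saddle_x(3,4) revenue_attains_max by simp_all
    show "\<exists>ps. unique_maximizer (\<lambda>p. lower_revenue G c A (markup_of_probs G c A p)) open_simplex ps \<and>
        zs = markup_of_probs G c A ps"
      unfolding zs_def by (rule unique_maximizer_probs[OF eq])
  qed (use min_x min_z saddle_x(1) saddle_z(1) has_probs_unique strictly_concave_revenue
      revenue_attains_max in blast)+
qed

end
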